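(* Let $G$ be a countable sofic group with identity $e$, $k\in\mathbb{N}$ and $X=\{0,1,\dots,k-1\}^G$. Let $a_0,\dots,a_{k-1}\in\mathbb{R}$ and define the continuous function $f:X\to\mathbb{R}$ by $f(x)=a_{x_e}$ where $x=(x_t)_{t\in G}$. Let $\alpha$ be the continuous action of $G$ on $X$ by the left shifts $s\cdot(x_t)_{t\in G}=(x_{s^{-1}t})_{t\in G}$. Let $\Sigma$ be a sofic approximation sequence of $G$ and let $\mu$ be the probability measure on $\{0,\dots,k-1\}$ defined by $$\mu(i)=\frac{\exp(a_i)}{\sum_{j=0}^{k-1}\exp(a_j)}\quad\text{for all }0\le i\le k-1.$$ Then $$P_\Sigma(f,X,G)=\sup\Big\{H(p)+\sum_{i=0}^{k-1}p(i)a_i:\ p\text{ is a probability measure on }\{0,\dots,k-1\}\Big\}=\log\Big(\sum_{j=0}^{k-1}\exp(a_j)\Big),$$ where $H(p)=\sum_{i=0}^{k-1}-p(i)\log p(i)$. Furthermore, the product measure $\mu^G$ on $X$ is an equilibrium state for $f$ with respect to $\Sigma$.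
   Context: **Product measure and conventions.** $0\log0=0$. $\mu^G$ is the unique Borel probability measure on $X=\{0,\dots,k-1\}^G$ with $\mu^G(\{(y_t)_{t\in G}:y_s=b_s\text{ for all }s\in F\})=\prod_{s\in F}\mu(b_s)$ for every nonempty finite $F\subset G$ and $(b_s)_{s\in F}\in\{0,\dots,k-1\}^F$. $X$ has the product topology. **Sofic groups.** For $d\in\mathbb{N}$ write $[d]=\{1,\dots,d\}$ and $\mathrm{Sym}(d)$ for the permutation group of $[d]$. A sofic approximation sequence for a countable group $G$ is a sequence $\Sigma=\{\sigma_i:G\to\mathrm{Sym}(d_i)\}_{i\in\mathbb{N}}$ of maps (not necessarily homomorphisms; $d_i\in\mathbb{N}$; $\sigma_{i,s}=\sigma_i(s)$) such that (1) $\lim_{i}\frac{1}{d_i}|\{a\in[d_i]:\sigma_{i,s}\sigma_{i,t}(a)=\sigma_{i,st}(a)\}|=1$ for all $s,t\in G$; (2) $\lim_i\frac1{d_i}|\{a\in[d_i]:\sigma_{i,s}(a)\ne\sigma_{i,t}(a)\}|=1$ for all distinct $s,t\in G$; (3) $\lim_i d_i=\infty$. $G$ is sofic if such a sequence exists. **Sofic topological pressure.** Let $G$ act continuously on a compact metrizable space $X$, $\alpha_s(x)=sx$, let $f\in C(X)$ be real valued, and let $\rho$ be a continuous pseudometric on $X$. For maps $\varphi,\psi:[d]\to X$ put $\rho_2(\varphi,\psi)=\big(\frac1d\sum_{a=1}^d\rho(\varphi(a),\psi(a))^2\big)^{1/2}$ and $\rho_\infty(\varphi,\psi)=\max_{1\le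 a\le d}\rho(\varphi(a),\psi(a))$. For a nonempty finite $F\subset G$, $\delta>0$ and $\sigma:G\to\mathrm{Sym}(d)$, let $\mathrm{Map}(\rho,F,\delta,\sigma)$ be the set of all $\varphi:[d]\to X$ with $\max_{s\in F}\rho_2(\alpha_s\circ\varphi,\varphi\circ\sigma_s)<\delta$. A subset $A$ of a pseudometric space $(Y,d_Y)$ is $(d_Y,\varepsilon)$-separated if $d_Y(x,y)\ge\varepsilon$ for all distinct $x,y\in A$; $N_\varepsilon(Y,d_Y)$ is the maximal cardinality of a finite $(d_Y,\varepsilon)$-separated subset of $Y$. For $\varepsilon>0$ let $$M^\varepsilon_{\Sigma,\infty}(f,X,G,\rho,F,\delta,\sigma)=\sup_{\mathcal{E}}\sum_{\varphi\in\mathcal{E}}\exp\Big(\sum_{a=1}^d f(\varphi(a))\Big),$$ with $\mathcal{E}$ running over the $(\rho_\infty,\varepsilon)$-separated subsets of $\mathrm{Map}(\rho,F,\delta,\sigma)$. Define $$P_{\Sigma,\infty}(f,X,G,\rho)=\sup_{\varepsilon>0}\ \inf_{F}\ \inf_{\delta>0}\ \limsup_{i\to\infty}\frac1{d_i}\log M^\varepsilon_{\Sigma,\infty}(f,X,G,\rho,F,\delta,\sigma_i)\in[-\infty,+\infty],$$ $F$ running over nonempty finite subsets of $G$, with $\log0=-\infty$. This value is the same for all compatible metrics $\rho$, and also for all continuous pseudometrics $\rho$ with respect to which $f$ is continuous and which are dynamically generating (for any distinct $x,y\in X$ there is $s\in G$ with $\rho(sx,sy)>0$); the common value is $P_\Sigma(f,X,G)$.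 **Sofic measure entropy.** Let $\nu$ be a $G$-invariant Borel probability measure on $X$ and $\rho$ a compatible metric (or a dynamically generating continuous pseudometric) on $X$. For a nonempty finite set $L$ of real valued continuous functions on $X$, let $\mathrm{Map}_\nu(\rho,F,L,\delta,\sigma)$ be the set of $\varphi\in\mathrm{Map}(\rho,F,\delta,\sigma)$ with $\big|\frac1d\sum_{j=1}^d g(\varphi(j))-\int_X g\,d\nu\big|<\delta$ for all $g\in L$. Then $$h_{\Sigma,\nu}(X,G)=\sup_{\varepsilon>0}\ \inf_F\ \inf_L\ \inf_{\delta>0}\ \limsup_{i\to\infty}\frac1{d_i}\log N_\varepsilon(\mathrm{Map}_\nu(\rho,F,L,\delta,\sigma_i),\rho_\infty),$$ $F$ and $L$ running over nonempty finite subsets of $G$ and of the real valued continuous functions on $X$ (the limsup is $-\infty$ if the sets are empty for all large $i$); this is independent of $\rho$. **Equilibrium state.** A $G$-invariant Borel probability measure $\nu$ on $X$ is an equilibrium state for $f$ with respect to $\Sigma$ if $P_\Sigma(f,X,G)=h_{\Sigma,\nu}(X,G)+\int_X f\,d\nu$. *)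

theory Defs
  imports "HOL-Probability.Probability" "HOL-Algebra.Group" "HOL-Combinatorics.Permutations"
begin

section \<open>Sofic approximation sequences\<close>

text \<open>A sequence \<open>\<Sigma>\<close> of maps \<open>\<sigma>\<^sub>i : G \<rightarrow> Sym(d\<^sub>i)\<close> is given by the pair \<open>d\<close>, \<open>\<sigma>\<close>.
  Since \<open>d\<^sub>i \<longlonglongrightarrow> \<infinity>\<close>, indices with \<open>d\<^sub>i = 0\<close> do not affect any of the limits below.\<close>

definition sofic_approximation ::
  "('g, 'm) monoid_scheme \<Rightarrow> (nat \<Rightarrow> nat) \<Rightarrow> (nat \<Rightarrow> 'g \<Rightarrow> nat \<Rightarrow> nat) \<Rightarrow> bool" where
  "sofic_approximation G d \<sigma> \<longleftrightarrow>
     (\<forall>i. \<forall>s\<in>carrier G. \<sigma> i s permutes {1..d i}) \<and>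
     (\<forall>s\<in>carrier G. \<forall>t\<in>carrier G.
        (\<lambda>i. real (card {a \<in> {1..d i}. \<sigma> i s (\<sigma> i t a) = \<sigma> i (s \<otimes>\<^bsub>G\<^esub> t) a}) / real (d i))
          \<longlonglongrightarrow> 1) \<and>
     (\<forall>s\<in>carrier G. \<forall>t\<in>carrier G. s \<noteq> t \<longrightarrow>
        (\<lambda>i. real (card {a \<in> {1..d i}. \<sigma> i s a \<noteq> \<sigma> i t a}) / real (d i)) \<longlonglongrightarrow> 1) \<and>
     filterlim d at_top sequentially"


section \<open>Model spaces\<close>

definition rho_2 :: "nat \<Rightarrow> ('x \<Rightarrow> 'x \<Rightarrow> real) \<Rightarrow> (nat \<Rightarrow> 'x) \<Rightarrow> (nat \<Rightarrow> 'x) \<Rightarrow> real" where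
  "rho_2 d \<rho> \<phi> \<psi> = sqrt ((1 / real d) * (\<Sum>a=1..d. (\<rho> (\<phi> a) (\<psi> a))\<^sup>2))"

definition rho_inf :: "nat \<Rightarrow> ('x \<Rightarrow> 'x \<Rightarrow> real) \<Rightarrow> (nat \<Rightarrow> 'x) \<Rightarrow> (nat \<Rightarrow> 'x) \<Rightarrow> real" where
  "rho_inf d \<rho> \<phi> \<psi> = (MAX a\<in>{1..d}. \<rho> (\<phi> a) (\<psi> a))"

text \<open>Maps \<open>[d] \<rightarrow> X\<close> are extensional functions, so that they are determined by their values
  on \<open>[d]\<close>.\<close>

definition Map_sofic ::
  "'x topology \<Rightarrow> ('g \<Rightarrow> 'x \<Rightarrow> 'x) \<Rightarrow> ('x \<Rightarrow> 'x \<Rightarrow> real) \<Rightarrow> 'g set \<Rightarrow> real \<Rightarrow> nat \<Rightarrow>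
   ('g \<Rightarrow> nat \<Rightarrow> nat) \<Rightarrow> (nat \<Rightarrow> 'x) set" where
  "Map_sofic X \<alpha> \<rho> F \<delta> d \<sigma> =
     {\<phi> \<in> {1..d} \<rightarrow>\<^sub>E topspace X. (MAX s\<in>F. rho_2 d \<rho> (\<alpha> s \<circ> \<phi>) (\<phi> \<circ> \<sigma> s)) < \<delta>}"

definition Map_sofic_measure ::
  "'x topology \<Rightarrow> ('g \<Rightarrow> 'x \<Rightarrow> 'x) \<Rightarrow> 'x measure \<Rightarrow> ('x \<Rightarrow> 'x \<Rightarrow> real) \<Rightarrow> 'g set \<Rightarrow>
   ('x \<Rightarrow> real) set \<Rightarrow> real \<Rightarrow> nat \<Rightarrow> ('g \<Rightarrow> nat \<Rightarrow> nat) \<Rightarrow> (nat \<Rightarrow> 'x) set" where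
  "Map_sofic_measure X \<alpha> \<nu> \<rho> F L \<delta> d \<sigma> =
     {\<phi> \<in> Map_sofic X \<alpha> \<rho> F \<delta> d \<sigma>.
        \<forall>g\<in>L. \<bar>(1 / real d) * (\<Sum>j=1..d. g (\<phi> j)) - integral\<^sup>L \<nu> g\<bar> < \<delta>}"

definition separated :: "('y \<Rightarrow> 'y \<Rightarrow> real) \<Rightarrow> real \<Rightarrow> 'y set \<Rightarrow> bool" where
  "separated D \<epsilon> A \<longleftrightarrow> (\<forall>x\<in>A. \<forall>y\<in>A. x \<noteq> y \<longrightarrow> D x y \<ge> \<epsilon>)"

definition max_separated :: "real \<Rightarrow> 'y set \<Rightarrow> ('y \<Rightarrow> 'y \<Rightarrow> real) \<Rightarrow> ennreal" where
  "max_separated \<epsilon> Y D = (SUP E\<in>{E. finite E \<and> E \<subseteq> Y \<and> separated D \<epsilon> E}. of_nat (card E))"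

definition ext_log :: "ennreal \<Rightarrow> ereal" where
  "ext_log x = (if x = 0 then -\<infinity> else if x = \<infinity> then \<infinity> else ereal (ln (enn2real x)))"


section \<open>Sofic topological pressure\<close>

text \<open>The supremum is taken over finite separated sets only because \<open>sum\<close> is \<open>0\<close> on infinite sets.
  This is no restriction: subsets of separated sets are separated and the summands are positive
  (and for compact \<open>X\<close> every separated set is finite anyway).\<close>

definition pressure_sum ::
  "('x \<Rightarrow> real) \<Rightarrow> 'x topology \<Rightarrow> ('g \<Rightarrow> 'x \<Rightarrow> 'x) \<Rightarrow> ('x \<Rightarrow> 'x \<Rightarrow> real) \<Rightarrow> real \<Rightarrow> 'g set \<Rightarrow> real \<Rightarrow>
   nat \<Rightarrow> ('g \<Rightarrow> nat \<Rightarrow> nat) \<Rightarrow> ennreal" where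
  "pressure_sum f X \<alpha> \<rho> \<epsilon> F \<delta> d \<sigma> =
     (SUP E\<in>{E. finite E \<and> E \<subseteq> Map_sofic X \<alpha> \<rho> F \<delta> d \<sigma> \<and> separated (rho_inf d \<rho>) \<epsilon> E}.
        \<Sum>\<phi>\<in>E. ennreal (exp (\<Sum>a=1..d. f (\<phi> a))))"

definition sofic_pressure_wrt ::
  "('g, 'm) monoid_scheme \<Rightarrow> (nat \<Rightarrow> nat) \<Rightarrow> (nat \<Rightarrow> 'g \<Rightarrow> nat \<Rightarrow> nat) \<Rightarrow> 'x topology \<Rightarrow>
   ('g \<Rightarrow> 'x \<Rightarrow> 'x) \<Rightarrow> ('x \<Rightarrow> real) \<Rightarrow> ('x \<Rightarrow> 'x \<Rightarrow> real) \<Rightarrow> ereal" where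
  "sofic_pressure_wrt G d \<sigma> X \<alpha> f \<rho> =
     (SUP \<epsilon>\<in>{0<..}. INF F\<in>{F. finite F \<and> F \<noteq> {} \<and> F \<subseteq> carrier G}. INF \<delta>\<in>{0<..}.
        limsup (\<lambda>i. ereal (1 / real (d i)) *
                    ext_log (pressure_sum f X \<alpha> \<rho> \<epsilon> F \<delta> (d i) (\<sigma> i))))"

definition compatible_metric :: "'x topology \<Rightarrow> ('x \<Rightarrow> 'x \<Rightarrow> real) \<Rightarrow> bool" where
  "compatible_metric X \<rho> \<longleftrightarrow>
     Metric_space (topspace X) \<rho> \<and> Metric_space.mtopology (topspace X) \<rho> = X"

text \<open>The pressure \<open>P\<^sub>\<Sigma>(f,X,G)\<close> is the common value of the above quantity for all compatible
  metrics.\<close>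

definition sofic_pressure ::
  "('g, 'm) monoid_scheme \<Rightarrow> (nat \<Rightarrow> nat) \<Rightarrow> (nat \<Rightarrow> 'g \<Rightarrow> nat \<Rightarrow> nat) \<Rightarrow> 'x topology \<Rightarrow>
   ('g \<Rightarrow> 'x \<Rightarrow> 'x) \<Rightarrow> ('x \<Rightarrow> real) \<Rightarrow> ereal" where
  "sofic_pressure G d \<sigma> X \<alpha> f =
     (THE P. \<forall>\<rho>. compatible_metric X \<rho> \<longrightarrow> sofic_pressure_wrt G d \<sigma> X \<alpha> f \<rho> = P)"


section \<open>Sofic measure entropy and equilibrium states\<close>

definition sofic_entropy_wrt ::
  "('g, 'm) monoid_scheme \<Rightarrow> (nat \<Rightarrow> nat) \<Rightarrow> (nat \<Rightarrow> 'g \<Rightarrow> nat \<Rightarrow> nat) \<Rightarrow> 'x topology \<Rightarrow>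
   ('g \<Rightarrow> 'x \<Rightarrow> 'x) \<Rightarrow> 'x measure \<Rightarrow> ('x \<Rightarrow> 'x \<Rightarrow> real) \<Rightarrow> ereal" where
  "sofic_entropy_wrt G d \<sigma> X \<alpha> \<nu> \<rho> =
     (SUP \<epsilon>\<in>{0<..}. INF F\<in>{F. finite F \<and> F \<noteq> {} \<and> F \<subseteq> carrier G}.
        INF L\<in>{L. finite L \<and> L \<noteq> {} \<and> (\<forall>g\<in>L. continuous_map X euclideanreal g)}. INF \<delta>\<in>{0<..}.
        limsup (\<lambda>i. ereal (1 / real (d i)) *
                    ext_log (max_separated \<epsilon> (Map_sofic_measure X \<alpha> \<nu> \<rho> F L \<delta> (d i) (\<sigma> i))
                                             (rho_inf (d i) \<rho>))))"

definition sofic_entropy ::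
  "('g, 'm) monoid_scheme \<Rightarrow> (nat \<Rightarrow> nat) \<Rightarrow> (nat \<Rightarrow> 'g \<Rightarrow> nat \<Rightarrow> nat) \<Rightarrow> 'x topology \<Rightarrow>
   ('g \<Rightarrow> 'x \<Rightarrow> 'x) \<Rightarrow> 'x measure \<Rightarrow> ereal" where
  "sofic_entropy G d \<sigma> X \<alpha> \<nu> =
     (THE h. \<forall>\<rho>. compatible_metric X \<rho> \<longrightarrow> sofic_entropy_wrt G d \<sigma> X \<alpha> \<nu> \<rho> = h)"

definition invariant_borel_prob ::
  "('g, 'm) monoid_scheme \<Rightarrow> 'x topology \<Rightarrow> ('g \<Rightarrow> 'x \<Rightarrow> 'x) \<Rightarrow> 'x measure \<Rightarrow> bool" where
  "invariant_borel_prob G X \<alpha> \<nu> \<longleftrightarrow>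
     prob_space \<nu> \<and> sets \<nu> = sigma_sets (topspace X) {U. openin X U} \<and>
     (\<forall>s\<in>carrier G. \<alpha> s \<in> measurable \<nu> \<nu> \<and> distr \<nu> \<nu> (\<alpha> s) = \<nu>)"

definition equilibrium_state ::
  "('g, 'm) monoid_scheme \<Rightarrow> (nat \<Rightarrow> nat) \<Rightarrow> (nat \<Rightarrow> 'g \<Rightarrow> nat \<Rightarrow> nat) \<Rightarrow> 'x topology \<Rightarrow>
   ('g \<Rightarrow> 'x \<Rightarrow> 'x) \<Rightarrow> ('x \<Rightarrow> real) \<Rightarrow> 'x measure \<Rightarrow> bool" where
  "equilibrium_state G d \<sigma> X \<alpha> f \<nu> \<longleftrightarrow>
     invariant_borel_prob G X \<alpha> \<nu> \<and>
     sofic_pressure G d \<sigma> X \<alpha> f = sofic_entropy G d \<sigma> X \<alpha> \<nu> + ereal (integral\<^sup>L \<nu> f)"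


section \<open>The full shift\<close>

definition full_shift :: "('g, 'm) monoid_scheme \<Rightarrow> nat \<Rightarrow> ('g \<Rightarrow> nat) topology" where
  "full_shift G k = product_topology (\<lambda>_. discrete_topology {..<k}) (carrier G)"

definition left_shift :: "('g, 'm) monoid_scheme \<Rightarrow> 'g \<Rightarrow> ('g \<Rightarrow> 'c) \<Rightarrow> 'g \<Rightarrow> 'c" where
  "left_shift G s x = (\<lambda>t\<in>carrier G. x (inv\<^bsub>G\<^esub> s \<otimes>\<^bsub>G\<^esub> t))"

definition prob_measures :: "nat \<Rightarrow> nat measure set" where
  "prob_measures k = {p. prob_space p \<and> sets p = Pow {..<k}}"

text \<open>The convention \<open>0 log 0 = 0\<close> holds since \<open>0 * y = 0\<close>.\<close>

definition shannon_entropy :: "nat \<Rightarrow> nat measure \<Rightarrow> real" where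
  "shannon_entropy k p = (\<Sum>i<k. - measure p {i} * ln (measure p {i}))"

definition gibbs_measure :: "nat \<Rightarrow> (nat \<Rightarrow> real) \<Rightarrow> nat measure" where
  "gibbs_measure k a = point_measure {..<k} (\<lambda>i. ennreal (exp (a i) / (\<Sum>j<k. exp (a j))))"

end

theory Submission
  imports Defs
begin

text \<open>
  Write \<open>Z\<close> for \<open>\<Sum>j<k. exp (a j)\<close> and \<open>c\<close> for the integral of the potential \<open>x \<mapsto> a (x \<one>)\<close> under the
  product of the Gibbs measure.  The argument compares approximately equivariant maps \<open>\<phi>\<close> from \<open>{1..n}\<close>
  to the full shift with colourings of \<open>{1..n}\<close>: the map gives the colouring \<open>j \<mapsto> \<phi> j \<one>\<close>, and a
  colouring \<open>\<omega>\<close> gives the map that sends \<open>j\<close> to the point with coordinates \<open>\<omega> (\<sigma> (inv t) j)\<close>.  The energy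
  of the map is the sum of the values of \<open>a\<close> along the colouring, and the sum of \<open>exp\<close> of this over
  \<^emph>\<open>all\<close> colourings is exactly \<open>Z ^ n\<close>.

  Upper bound on the pressure (\<open>pressure_sum_upper_bound\<close>): on a finite window, a map is determined by
  its colouring except at a small proportion of the sites.  Recording the exceptional patterns costs only
  a factor \<open>exp (n \<eta>)\<close>, so a sum over separated maps is at most \<open>Z ^ n * exp (n \<eta>)\<close>.

  Lower bound on the entropy (\<open>eventually_max_separated_ge\<close>): every colouring gives an approximately
  equivariant map, and distinct colourings give maps separated at a fixed scale.  If the sites are
  coloured independently with the Gibbs weights, a second moment estimate shows that all pattern
  frequencies converge in probability, so that the map samples the product measure with probability
  tending to 1.  A colouring whose map does this for the potential has weight about \<open>exp (n (c - ln Z))\<close>,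
  hence there are about \<open>exp (n (ln Z - c))\<close> of them.

  The maps counted by the entropy have energy about \<open>n c\<close> (\<open>max_separated_le_pressure_sum\<close>), so entropy
  plus \<open>c\<close> is at most the pressure already at finite scales.  With the two bounds above this squeezes the
  pressure to \<open>ln Z\<close> and the entropy of the product measure to \<open>ln Z - c\<close>, for every compatible metric.
  A compatible metric exists because the group is countable, so the definite descriptions of pressure and
  entropy denote these values.  The variational formula over single-site measures is Gibbs' inequality,
  with equality at the Gibbs measure.\<close>

section \<open>Windows in the full shift\<close>

lemma topspace_full_shift: "topspace (full_shift G k) = (carrier G \<rightarrow>\<^sub>E {..<k})"
  by (simp add: full_shift_def)

lemma compact_space_full_shift: "compact_space (full_shift G k)"
  by (simp add: full_shift_def compact_space_product_topology compact_space_discrete_topology)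

lemma metrizable_space_full_shift:
  assumes "countable (carrier G)"
  shows "metrizable_space (full_shift G k)"
  using assms by (simp add: full_shift_def metrizable_space_product_topology
      metrizable_space_discrete_topology)

lemma ex_compatible_metric:
  assumes "countable (carrier G)"
  shows "\<exists>\<rho>. compatible_metric (full_shift G k) \<rho>"
proof -
  obtain M \<rho> where "Metric_space M \<rho>" "full_shift G k = Metric_space.mtopology M \<rho>"
    using metrizable_space_full_shift[OF assms] unfolding metrizable_space_def by blast
  then show ?thesis
    unfolding compatible_metric_def by (metis Metric_space.topspace_mtopology)
qed

lemma openin_cylinder:
  assumes "finite T" "T \<subseteq> carrier G"
  shows "openin (full_shift G k) {y \<in> topspace (full_shift G k). \<forall>t\<in>T. y t = x t}"
  unfolding full_shift_def openin_product_topology_alt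
proof (intro ballI)
  fix y assume y: "y \<in> {y \<in> topspace (product_topology (\<lambda>_. discrete_topology {..<k}) (carrier G)).
    \<forall>t\<in>T. y t = x t}"
  let ?U = "\<lambda>i. if i \<in> T then {y i} else {..<k}"
  show "\<exists>U. finite {i \<in> carrier G. U i \<noteq> topspace (discrete_topology {..<k})} \<and>
      (\<forall>i\<in>carrier G. openin (discrete_topology {..<k}) (U i)) \<and> y \<in> Pi\<^sub>E (carrier G) U \<and>
      Pi\<^sub>E (carrier G) U \<subseteq> {y \<in> topspace (product_topology (\<lambda>_. discrete_topology {..<k}) (carrier G)).
        \<forall>t\<in>T. y t = x t}"
  proof (intro exI[of _ ?U] conjI)
    show "finite {i \<in> carrier G. ?U i \<noteq> topspace (discrete_topology {..<k})}"
      by (rule finite_subset[OF _ assms(1)]) auto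
    show "\<forall>i\<in>carrier G. openin (discrete_topology {..<k}) (?U i)"
      using y by (auto simp: PiE_iff)
    show "y \<in> Pi\<^sub>E (carrier G) ?U"
      using y by (auto simp: PiE_iff)
    show "Pi\<^sub>E (carrier G) ?U \<subseteq>
        {y \<in> topspace (product_topology (\<lambda>_. discrete_topology {..<k}) (carrier G)).
          \<forall>t\<in>T. y t = x t}"
    proof
      fix z assume z: "z \<in> Pi\<^sub>E (carrier G) ?U"
      have zi: "z i \<in> ?U i" if "i \<in> carrier G" for i
        using z that by (rule PiE_mem)
      have "z i < k" if "i \<in> carrier G" for i
        using zi[OF that] y that by (auto split: if_splits simp: PiE_iff)
      moreover have "z t = x t" if "t \<in> T" for t
        using zi[of t] y that assms(2) by auto
      ultimately show "z \<in> {y \<in> topspace (product_topology (\<lambda>_. discrete_topology {..<k}) (carrier G)).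
          \<forall>t\<in>T. y t = x t}"
        using z by (auto simp: PiE_iff)
    qed
  qed
qed

lemma open_contains_cylinder:
  assumes "openin (full_shift G k) U" "x \<in> U"
  obtains T where "finite T" "T \<subseteq> carrier G"
    "\<And>y. y \<in> topspace (full_shift G k) \<Longrightarrow> \<forall>t\<in>T. y t = x t \<Longrightarrow> y \<in> U"
proof -
  obtain V where V: "finite {i \<in> carrier G. V i \<noteq> {..<k}}" "x \<in> Pi\<^sub>E (carrier G) V"
    "Pi\<^sub>E (carrier G) V \<subseteq> U"
    using assms unfolding full_shift_def openin_product_topology_alt by force
  show thesis
  proof (rule that[of "{i \<in> carrier G. V i \<noteq> {..<k}}"])
    fix y assume y: "y \<in> topspace (full_shift G k)"
      "\<forall>t\<in>{i \<in> carrier G. V i \<noteq> {..<k}}. y t = x t"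
    have "y i \<in> V i" if "i \<in> carrier G" for i
      using y V(2) that by (cases "V i = {..<k}") (auto simp: topspace_full_shift PiE_iff)
    then have "y \<in> Pi\<^sub>E (carrier G) V"
      using y by (auto simp: topspace_full_shift PiE_iff)
    then show "y \<in> U" using V(3) by blast
  qed (use V in auto)
qed

text \<open>Compactness turns any pointwise choice of neighbourhoods into one finite window: cover the
  space by cylinders contained in the chosen neighbourhoods and collect the finitely many
  coordinates that a finite subcover mentions.\<close>

lemma cover_finite_window:
  assumes U: "\<And>x. x \<in> topspace (full_shift G k) \<Longrightarrow> openin (full_shift G k) (U x) \<and> x \<in> U x"
  obtains T where "finite T" "T \<subseteq> carrier G"
    "\<And>x y. x \<in> topspace (full_shift G k) \<Longrightarrow> y \<in> topspace (full_shift G k) \<Longrightarrow>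
      \<forall>t\<in>T. x t = y t \<Longrightarrow> \<exists>z\<in>topspace (full_shift G k). x \<in> U z \<and> y \<in> U z"
proof -
  let ?X = "topspace (full_shift G k)"
  have "\<exists>T. finite T \<and> T \<subseteq> carrier G \<and> (\<forall>y\<in>?X. (\<forall>t\<in>T. y t = x t) \<longrightarrow> y \<in> U x)" if "x \<in> ?X" for x
    by (rule open_contains_cylinder[OF conjunct1[OF U[OF that]] conjunct2[OF U[OF that]]]) blast
  then obtain T where T: "\<And>x. x \<in> ?X \<Longrightarrow> finite (T x) \<and> T x \<subseteq> carrier G \<and>
      (\<forall>y\<in>?X. (\<forall>t\<in>T x. y t = x t) \<longrightarrow> y \<in> U x)"
    by metis
  define C where "C x = {y \<in> ?X. \<forall>t\<in>T x. y t = x t}" for x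
  have "\<exists>\<F>. finite \<F> \<and> \<F> \<subseteq> C ` ?X \<and> ?X \<subseteq> \<Union>\<F>"
  proof (rule compactinD)
    show "compactin (full_shift G k) ?X"
      using compact_space_full_shift by (simp add: compact_space_def)
    show "openin (full_shift G k) V" if "V \<in> C ` ?X" for V
      using that T unfolding C_def by (auto intro!: openin_cylinder)
    show "?X \<subseteq> \<Union> (C ` ?X)"
      by (auto simp: C_def)
  qed
  then obtain Z where Z: "finite Z" "Z \<subseteq> ?X" "?X \<subseteq> (\<Union>z\<in>Z. C z)"
    by (metis finite_subset_image)
  show thesis
  proof (rule that[of "\<Union>z\<in>Z. T z"])
    fix x y assume xy: "x \<in> ?X" "y \<in> ?X" "\<forall>t\<in>\<Union>z\<in>Z. T z. x t = y t"
    obtain z where z: "z \<in> Z" "x \<in> C z" using Z(3) xy(1) by blast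
    then have "y \<in> C z" using xy by (auto simp: C_def)
    then have "x \<in> U z \<and> y \<in> U z" using z T Z(2) by (auto simp: C_def)
    then show "\<exists>z\<in>?X. x \<in> U z \<and> y \<in> U z" using z Z(2) by blast
  qed (use Z T in auto)
qed

lemma window_continuous_map:
  assumes g: "continuous_map (full_shift G k) euclideanreal g" and "\<epsilon> > 0"
  obtains T where "finite T" "T \<subseteq> carrier G"
    "\<And>x y. x \<in> topspace (full_shift G k) \<Longrightarrow> y \<in> topspace (full_shift G k) \<Longrightarrow>
      \<forall>t\<in>T. x t = y t \<Longrightarrow> \<bar>g x - g y\<bar> < \<epsilon>"
proof -
  let ?X = "topspace (full_shift G k)"
  define U where "U x = {y \<in> ?X. g y \<in> ball (g x) (\<epsilon>/2)}" for x
  obtain T where T: "finite T" "T \<subseteq> carrier G"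
    "\<And>x y. x \<in> ?X \<Longrightarrow> y \<in> ?X \<Longrightarrow> \<forall>t\<in>T. x t = y t \<Longrightarrow> \<exists>z\<in>?X. x \<in> U z \<and> y \<in> U z"
  proof (rule cover_finite_window[of G k U])
    show "openin (full_shift G k) (U x) \<and> x \<in> U x" if "x \<in> ?X" for x
      unfolding U_def using openin_continuous_map_preimage[OF g, of "ball (g x) (\<epsilon>/2)"] that \<open>\<epsilon> > 0\<close>
      by auto
  qed blast
  show thesis
  proof (rule that[OF T(1,2)])
    fix x y assume "x \<in> ?X" "y \<in> ?X" "\<forall>t\<in>T. x t = y t"
    then obtain z where "x \<in> U z" "y \<in> U z" using T(3) by blast
    then have "\<bar>g z - g x\<bar> < \<epsilon>/2" "\<bar>g z - g y\<bar> < \<epsilon>/2" by (auto simp: U_def dist_real_def)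
    then show "\<bar>g x - g y\<bar> < \<epsilon>" by argo
  qed
qed

lemma window_compatible_metric:
  assumes \<rho>: "compatible_metric (full_shift G k) \<rho>" and "\<epsilon> > 0"
  obtains T where "finite T" "T \<subseteq> carrier G"
    "\<And>x y. x \<in> topspace (full_shift G k) \<Longrightarrow> y \<in> topspace (full_shift G k) \<Longrightarrow>
      \<forall>t\<in>T. x t = y t \<Longrightarrow> \<rho> x y < \<epsilon>"
proof -
  let ?X = "topspace (full_shift G k)"
  interpret Metric_space ?X \<rho> using \<rho> by (simp add: compatible_metric_def)
  have top: "mtopology = full_shift G k" using \<rho> by (simp add: compatible_metric_def)
  obtain T where T: "finite T" "T \<subseteq> carrier G"
    "\<And>x y. x \<in> ?X \<Longrightarrow> y \<in> ?X \<Longrightarrow> \<forall>t\<in>T. x t = y t \<Longrightarrow> \<exists>z\<in>?X. x \<in> mball z (\<epsilon>/2) \<and> y \<in> mball z (\<epsilon>/2)"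
  proof (rule cover_finite_window[of G k "\<lambda>z. mball z (\<epsilon>/2)"])
    show "openin (full_shift G k) (mball x (\<epsilon>/2)) \<and> x \<in> mball x (\<epsilon>/2)" if "x \<in> ?X" for x
      using openin_mball[of x "\<epsilon>/2"] that \<open>\<epsilon> > 0\<close> by (simp add: top)
  qed blast
  show thesis
  proof (rule that[OF T(1,2)])
    fix x y assume xy: "x \<in> ?X" "y \<in> ?X" "\<forall>t\<in>T. x t = y t"
    then obtain z where z: "z \<in> ?X" "\<rho> z x < \<epsilon>/2" "\<rho> z y < \<epsilon>/2" using T(3) by (metis in_mball)
    then show "\<rho> x y < \<epsilon>" using triangle[of x z y] xy commute[of x z] by simp
  qed
qed

text \<open>The sets on which the coordinate \<open>t\<close> is constant are open and cover the compact space, so \<open>r\<close> can be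
any Lebesgue number of this cover.\<close>

lemma compatible_metric_separates_coordinate:
  assumes \<rho>: "compatible_metric (full_shift G k) \<rho>" and "t \<in> carrier G"
  obtains r where "r > 0" "\<And>x y. x \<in> topspace (full_shift G k) \<Longrightarrow>
      y \<in> topspace (full_shift G k) \<Longrightarrow> \<rho> x y < r \<Longrightarrow> x t = y t"
proof -
  let ?X = "topspace (full_shift G k)"
  interpret Metric_space ?X \<rho> using \<rho> by (simp add: compatible_metric_def)
  have top: "mtopology = full_shift G k" using \<rho> by (simp add: compatible_metric_def)
  define C where "C x = {y \<in> ?X. \<forall>s\<in>{t}. y s = x s}" for x
  have "\<exists>r>0. \<forall>x\<in>?X. \<exists>U\<in>C ` ?X. mball x r \<subseteq> U"
  proof (rule lebesgue_number)
    show "compactin mtopology ?X"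
      using compact_space_full_shift by (simp add: compact_space_def top)
    show "?X \<subseteq> \<Union> (C ` ?X)" by (auto simp: C_def)
    show "openin mtopology U" if "U \<in> C ` ?X" for U
      using that assms(2) unfolding top C_def by (auto simp only: intro!: openin_cylinder)
  qed
  then obtain r where r: "r > 0" "\<And>x. x \<in> ?X \<Longrightarrow> \<exists>U\<in>C ` ?X. mball x r \<subseteq> U" by blast
  show thesis
  proof (rule that[OF r(1)])
    fix x y assume xy: "x \<in> ?X" "y \<in> ?X" "\<rho> x y < r"
    then obtain z where "mball x r \<subseteq> C z" using r(2) by blast
    moreover have "x \<in> mball x r" "y \<in> mball x r" using xy r(1) by auto
    ultimately have "x \<in> C z" "y \<in> C z" by blast+
    then show "x t = y t" by (simp add: C_def)
  qed
qed

lemma compatible_metric_bounded: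
  assumes \<rho>: "compatible_metric (full_shift G k) \<rho>"
  obtains D where "D > 0" "\<And>x y. x \<in> topspace (full_shift G k) \<Longrightarrow>
      y \<in> topspace (full_shift G k) \<Longrightarrow> \<rho> x y \<le> D"
proof -
  let ?X = "topspace (full_shift G k)"
  interpret Metric_space ?X \<rho> using \<rho> by (simp add: compatible_metric_def)
  have "mtopology = full_shift G k" using \<rho> by (simp add: compatible_metric_def)
  then have "mbounded ?X"
    using compact_space_full_shift[of G k] by (intro compactin_imp_mbounded) (simp add: compact_space_def)
  then show thesis
    using that unfolding mbounded_alt_pos by blast
qed

lemma continuous_map_coordinate_function:
  assumes "t \<in> carrier G"
  shows "continuous_map (full_shift G k) euclideanreal (\<lambda>x. a (x t))"
proof -
  have "continuous_map (full_shift G k) (discrete_topology {..<k}) (\<lambda>x. x t)"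
    unfolding full_shift_def using assms by (rule continuous_map_product_coordinates)
  moreover have "continuous_map (discrete_topology {..<k}) euclideanreal a"
    by simp
  ultimately show ?thesis
    using continuous_map_compose[of _ _ "\<lambda>x. x t" _ a] by (simp add: o_def)
qed

section \<open>Upper bound: encoding approximately equivariant maps\<close>

lemma card_large_mult_le_sum_squares:
  fixes u :: "'b \<Rightarrow> real"
  assumes "finite A" "r \<ge> 0"
  shows "real (card {x \<in> A. u x \<ge> r}) * r\<^sup>2 \<le> (\<Sum>x\<in>A. (u x)\<^sup>2)"
proof -
  have "real (card {x \<in> A. u x \<ge> r}) * r\<^sup>2 = (\<Sum>x\<in>{x \<in> A. u x \<ge> r}. r\<^sup>2)" by simp
  also have "\<dots> \<le> (\<Sum>x\<in>{x \<in> A. u x \<ge> r}. (u x)\<^sup>2)"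
    using assms(2) by (intro sum_mono) (simp add: power_mono)
  also have "\<dots> \<le> (\<Sum>x\<in>A. (u x)\<^sup>2)"
    by (rule sum_mono2) (simp_all add: assms(1))
  finally show ?thesis .
qed

lemma Map_sofic_sum_squares:
  assumes "\<phi> \<in> Map_sofic X \<alpha> \<rho> F \<delta> n \<sigma>" "s \<in> F" "finite F" "n > 0" "\<delta> > 0"
  shows "(\<Sum>a=1..n. (\<rho> (\<alpha> s (\<phi> a)) (\<phi> (\<sigma> s a)))\<^sup>2) \<le> real n * \<delta>\<^sup>2"
proof -
  have "rho_2 n \<rho> (\<alpha> s \<circ> \<phi>) (\<phi> \<circ> \<sigma> s) \<le> (MAX s\<in>F. rho_2 n \<rho> (\<alpha> s \<circ> \<phi>) (\<phi> \<circ> \<sigma> s))"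
    using assms by (intro Max_ge) auto
  also have "\<dots> < \<delta>" using assms(1) by (simp add: Map_sofic_def)
  finally have "sqrt ((1 / real n) * (\<Sum>a=1..n. (\<rho> (\<alpha> s (\<phi> a)) (\<phi> (\<sigma> s a)))\<^sup>2)) < \<delta>"
    by (simp add: rho_2_def)
  then have "(1 / real n) * (\<Sum>a=1..n. (\<rho> (\<alpha> s (\<phi> a)) (\<phi> (\<sigma> s a)))\<^sup>2) < \<delta>\<^sup>2"
    using \<open>\<delta> > 0\<close> by (subst real_sqrt_less_iff[symmetric]) simp
  then show ?thesis
    using assms(4) by (simp add: field_simps)
qed

text \<open>Every coordinate of a point is the identity coordinate of one of its translates.  Hence the colouring
\<open>j \<mapsto> \<phi> j \<one>\<close> of an equivariant map \<open>\<phi>\<close> determines all of \<open>\<phi>\<close>.\<close>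

lemma left_shift_one:
  assumes "group G" "t \<in> carrier G"
  shows "left_shift G (inv\<^bsub>G\<^esub> t) x \<one>\<^bsub>G\<^esub> = x t"
proof -
  interpret group G by fact
  show ?thesis using assms(2) by (simp add: left_shift_def)
qed

text \<open>If \<open>\<phi>\<close> were equivariant, then \<open>\<phi> j t\<close> would be the colour of the site \<open>\<sigma> (inv t) j\<close>.  A site where this
fails contributes at least \<open>r\<^sup>2\<close> to the sum of squares that \<open>Map_sofic\<close> bounds by \<open>n \<delta>\<^sup>2\<close>, for one of
the \<open>card T\<close> group elements involved; so Markov's inequality applies.\<close>

lemma card_inconsistent_sites_le:
  fixes G :: "('g, 'm) monoid_scheme" (structure)
  assumes "group G" and \<phi>: "\<phi> \<in> Map_sofic (full_shift G k) (left_shift G) \<rho> ((\<lambda>t. inv\<^bsub>G\<^esub> t) ` T) \<delta> n \<sigma>"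
    and T: "finite T" "T \<subseteq> carrier G" and "n > 0" "\<delta> > 0" "r > 0"
    and perm: "\<And>s. s \<in> carrier G \<Longrightarrow> \<sigma> s permutes {1..n}"
    and r: "\<And>x y. x \<in> topspace (full_shift G k) \<Longrightarrow> y \<in> topspace (full_shift G k) \<Longrightarrow>
      \<rho> x y < r \<Longrightarrow> x \<one>\<^bsub>G\<^esub> = y \<one>\<^bsub>G\<^esub>"
  shows "real (card {j \<in> {1..n}. \<exists>t\<in>T. \<phi> j t \<noteq> \<phi> (\<sigma> (inv\<^bsub>G\<^esub> t) j) \<one>\<^bsub>G\<^esub>})
    \<le> real (card T) * (real n * \<delta>\<^sup>2 / r\<^sup>2)"
proof -
  interpret group G by fact
  let ?X = "topspace (full_shift G k)"
  let ?bad = "\<lambda>t. {j \<in> {1..n}. \<phi> j t \<noteq> \<phi> (\<sigma> (inv\<^bsub>G\<^esub> t) j) \<one>\<^bsub>G\<^esub>}"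
  have \<phi>X: "\<phi> j \<in> ?X" if "j \<in> {1..n}" for j
    using \<phi> that by (auto simp: Map_sofic_def)
  have shiftX: "left_shift G s x \<in> ?X" if "s \<in> carrier G" "x \<in> ?X" for s x
    using that by (auto simp: topspace_full_shift left_shift_def PiE_iff)
  have one: "real (card (?bad t)) \<le> real n * \<delta>\<^sup>2 / r\<^sup>2" if "t \<in> T" for t
  proof -
    have tG: "t \<in> carrier G" "inv t \<in> carrier G" using that T by auto
    let ?u = "\<lambda>j. \<rho> (left_shift G (inv t) (\<phi> j)) (\<phi> (\<sigma> (inv t) j))"
    have "?bad t \<subseteq> {j \<in> {1..n}. ?u j \<ge> r}"
    proof clarsimp
      fix j assume j: "Suc 0 \<le> j" "j \<le> n" "\<phi> j t \<noteq> \<phi> (\<sigma> (inv t) j) \<one>"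
      then have j': "j \<in> {1..n}" by simp
      have "\<sigma> (inv t) j \<in> {1..n}" using permutes_in_image[OF perm[OF tG(2)]] j' by blast
      then have "\<phi> (\<sigma> (inv t) j) \<in> ?X" by (rule \<phi>X)
      note near = r[OF shiftX[OF tG(2) \<phi>X[OF j']] this]
      show "r \<le> ?u j"
      proof (rule ccontr)
        assume "\<not> r \<le> ?u j"
        then have "left_shift G (inv t) (\<phi> j) \<one> = \<phi> (\<sigma> (inv t) j) \<one>" by (intro near) simp
        then show False using left_shift_one[OF assms(1) tG(1), of "\<phi> j"] j(3) by simp
      qed
    qed
    then have "real (card (?bad t)) * r\<^sup>2 \<le> real (card {j \<in> {1..n}. ?u j \<ge> r}) * r\<^sup>2"
      by (intro mult_right_mono of_nat_mono card_mono) auto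
    also have "\<dots> \<le> (\<Sum>j=1..n. (?u j)\<^sup>2)"
      using \<open>r > 0\<close> by (intro card_large_mult_le_sum_squares) auto
    also have "\<dots> \<le> real n * \<delta>\<^sup>2"
      using that T assms(5,6) by (intro Map_sofic_sum_squares[OF \<phi>]) auto
    finally show ?thesis using \<open>r > 0\<close> by (simp add: field_simps)
  qed
  have "real (card {j \<in> {1..n}. \<exists>t\<in>T. \<phi> j t \<noteq> \<phi> (\<sigma> (inv t) j) \<one>}) = real (card (\<Union>t\<in>T. ?bad t))"
    by (intro arg_cong[where f="\<lambda>A. real (card A)"]) auto
  also have "\<dots> \<le> (\<Sum>t\<in>T. real (card (?bad t)))"
    unfolding of_nat_sum[symmetric] by (intro of_nat_mono card_UN_le T(1))
  also have "\<dots> \<le> (\<Sum>t\<in>T. real n * \<delta>\<^sup>2 / r\<^sup>2)" by (intro sum_mono one)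
  finally show ?thesis by simp
qed

text \<open>Encode \<open>\<phi>\<close> by its colouring together with, at each inconsistent site, the true pattern on the window
\<open>T\<close>.  The code determines \<open>\<phi>\<close> on \<open>T\<close> at every site, so it is injective on a separated family.  Instead
of counting how many sets of inconsistent sites are possible, weigh each recorded pattern by \<open>\<tau>\<close>: a map
with at most \<open>\<kappa> n\<close> inconsistent sites loses a factor of at most \<open>\<tau> powr (\<kappa> n)\<close>, whereas the sum of the
weights of all codes factorises over the sites.\<close>

lemma pressure_sum_finite_family_le:
  fixes G :: "('g, 'm) monoid_scheme" (structure) and a :: "nat \<Rightarrow> real"
  assumes G: "group G" and \<tau>: "0 < \<tau>" "\<tau> \<le> 1"
    and T: "finite T" "T \<subseteq> carrier G" and "n > 0" "\<delta> > 0" "r > 0"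
    and perm: "\<And>s. s \<in> carrier G \<Longrightarrow> \<sigma> s permutes {1..n}"
    and r: "\<And>x y. x \<in> topspace (full_shift G k) \<Longrightarrow> y \<in> topspace (full_shift G k) \<Longrightarrow>
      \<rho> x y < r \<Longrightarrow> x \<one>\<^bsub>G\<^esub> = y \<one>\<^bsub>G\<^esub>"
    and win: "\<And>x y. x \<in> topspace (full_shift G k) \<Longrightarrow> y \<in> topspace (full_shift G k) \<Longrightarrow>
      \<forall>t\<in>T. x t = y t \<Longrightarrow> \<rho> x y < \<epsilon>"
    and \<delta>: "real (card T) * (\<delta>\<^sup>2 / r\<^sup>2) \<le> \<kappa>"
    and E: "finite E" "E \<subseteq> Map_sofic (full_shift G k) (left_shift G) \<rho> ((\<lambda>t. inv\<^bsub>G\<^esub> t) ` T) \<delta> n \<sigma>"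
      "separated (rho_inf n \<rho>) \<epsilon> E"
  shows "(\<Sum>\<phi>\<in>E. exp (\<Sum>j=1..n. a (\<phi> j \<one>\<^bsub>G\<^esub>)))
    \<le> \<tau> powr (- \<kappa> * n) * ((\<Sum>j<k. exp (a j)) * (1 + \<tau> * real (card (T \<rightarrow>\<^sub>E {..<k})))) ^ n"
proof -
  interpret group G by fact
  let ?X = "topspace (full_shift G k)"
  let ?W = "T \<rightarrow>\<^sub>E {..<k}"
  let ?B = "{..<k} \<times> insert None (Some ` ?W)"
  have finW: "finite ?W" using T(1) by (intro finite_PiE) auto
  then have finB: "finite ?B" by simp
  define ok where "ok \<phi> j \<longleftrightarrow> (\<forall>t\<in>T. \<phi> j t = \<phi> (\<sigma> (inv t) j) \<one>)" for \<phi> :: "nat \<Rightarrow> 'g \<Rightarrow> nat" and j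
  \<comment> \<open>With the value \<open>None\<close> the pattern at \<open>j\<close> can be read off the colouring.\<close>
  define code where "code \<phi> = (\<lambda>j\<in>{1..n}. (\<phi> j \<one>, if ok \<phi> j then None else Some (restrict (\<phi> j) T)))"
    for \<phi> :: "nat \<Rightarrow> 'g \<Rightarrow> nat"
  define v where "v b = exp (a (fst b)) * (if snd b = None then 1 else \<tau>)"
    for b :: "nat \<times> ('g \<Rightarrow> nat) option"
  have \<phi>X: "\<phi> j \<in> ?X" if "\<phi> \<in> E" "j \<in> {1..n}" for \<phi> j
  proof -
    have "\<phi> \<in> {1..n} \<rightarrow>\<^sub>E ?X" using subsetD[OF E(2) that(1)] by (simp add: Map_sofic_def)
    then show ?thesis using that(2) by (rule PiE_mem)
  qed
  have code_in: "code ` E \<subseteq> {1..n} \<rightarrow>\<^sub>E ?B"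
  proof -
    have "(\<phi> j \<one>, if ok \<phi> j then None else Some (restrict (\<phi> j) T)) \<in> ?B" if "\<phi> \<in> E" "j \<in> {1..n}" for \<phi> j
      using \<phi>X[OF that] T(2) by (auto simp: topspace_full_shift PiE_iff image_iff)
    then show ?thesis by (auto simp: code_def)
  qed
  have inj: "inj_on code E"
  proof (rule inj_onI, rule ccontr)
    fix \<phi> \<psi> assume *: "\<phi> \<in> E" "\<psi> \<in> E" "code \<phi> = code \<psi>" "\<phi> \<noteq> \<psi>"
    have eq: "\<phi> j \<one> = \<psi> j \<one>" "ok \<phi> j = ok \<psi> j" "\<not> ok \<phi> j \<Longrightarrow> restrict (\<phi> j) T = restrict (\<psi> j) T"
      if "j \<in> {1..n}" for j
      using fun_cong[OF *(3), of j] that by (auto simp: code_def split: if_splits)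
    have agree: "\<forall>t\<in>T. \<phi> j t = \<psi> j t" if j: "j \<in> {1..n}" for j
    proof (cases "ok \<phi> j")
      case True
      show ?thesis
      proof
        fix t assume t: "t \<in> T"
        have "\<sigma> (inv t) j \<in> {1..n}"
          using permutes_in_image[OF perm, of "inv t"] j t T(2) by blast
        then show "\<phi> j t = \<psi> j t" using True eq[OF j] t eq(1) by (simp add: ok_def)
      qed
    next
      case False
      then show ?thesis using eq(3)[OF j] by (metis restrict_apply')
    qed
    have "rho_inf n \<rho> \<phi> \<psi> < \<epsilon>"
      unfolding rho_inf_def using \<open>n > 0\<close> agree \<phi>X *(1,2) by (subst Max_less_iff) (auto intro!: win)
    then show False using E(3) * by (force simp: separated_def)
  qed
  \<comment> \<open>The inconsistent sites are exactly those whose code carries the factor \<open>\<tau>\<close>.\<close>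
  have term_le: "exp (\<Sum>j=1..n. a (\<phi> j \<one>)) \<le> \<tau> powr (- \<kappa> * n) * (\<Prod>j=1..n. v (code \<phi> j))"
    if \<phi>: "\<phi> \<in> E" for \<phi>
  proof -
    let ?b = "card {j \<in> {1..n}. \<not> ok \<phi> j}"
    have \<phi>M: "\<phi> \<in> Map_sofic (full_shift G k) (left_shift G) \<rho> ((\<lambda>t. inv t) ` T) \<delta> n \<sigma>"
      using E(2) \<phi> by blast
    have "real (card {j \<in> {1..n}. \<exists>t\<in>T. \<phi> j t \<noteq> \<phi> (\<sigma> (inv t) j) \<one>})
        \<le> real (card T) * (real n * \<delta>\<^sup>2 / r\<^sup>2)"
      by (rule card_inconsistent_sites_le[where k=k and \<rho>=\<rho>]; fact)
    then have "real ?b \<le> real (card T) * (real n * \<delta>\<^sup>2 / r\<^sup>2)" by (simp add: ok_def)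
    also have "\<dots> \<le> \<kappa> * n" using mult_right_mono[OF \<delta>, of "real n"] by (simp add: algebra_simps)
    finally have b: "real ?b \<le> \<kappa> * n" .
    have "(\<Prod>j=1..n. v (code \<phi> j)) = (\<Prod>j=1..n. exp (a (\<phi> j \<one>))) * (\<Prod>j=1..n. if \<not> ok \<phi> j then \<tau> else 1)"
      unfolding prod.distrib[symmetric] by (intro prod.cong) (auto simp: v_def code_def)
    also have "(\<Prod>j=1..n. if \<not> ok \<phi> j then \<tau> else 1) = \<tau> ^ ?b"
      by (subst prod.inter_filter[symmetric]) auto
    also have "(\<Prod>j=1..n. exp (a (\<phi> j \<one>))) = exp (\<Sum>j=1..n. a (\<phi> j \<one>))" by (simp add: exp_sum)
    finally have "\<tau> powr (- \<kappa> * n) * (\<Prod>j=1..n. v (code \<phi> j))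
        = exp (\<Sum>j=1..n. a (\<phi> j \<one>)) * (\<tau> powr (real ?b - \<kappa> * n))"
      using \<tau> by (simp add: powr_realpow[symmetric] powr_add[symmetric])
    moreover have "\<tau> powr (real ?b - \<kappa> * n) \<ge> \<tau> powr 0"
      using \<tau> b by (intro powr_mono') auto
    ultimately show ?thesis using \<tau> by simp
  qed
  have "(\<Sum>\<phi>\<in>E. exp (\<Sum>j=1..n. a (\<phi> j \<one>))) \<le> (\<Sum>\<phi>\<in>E. \<tau> powr (- \<kappa> * n) * (\<Prod>j=1..n. v (code \<phi> j)))"
    by (intro sum_mono term_le)
  also have "\<dots> = \<tau> powr (- \<kappa> * n) * (\<Sum>g\<in>code ` E. \<Prod>j=1..n. v (g j))"
    by (simp add: sum.reindex[OF inj] sum_distrib_left)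
  also have "(\<Sum>g\<in>code ` E. \<Prod>j=1..n. v (g j)) \<le> (\<Sum>g\<in>{1..n} \<rightarrow>\<^sub>E ?B. \<Prod>j=1..n. v (g j))"
    using \<tau> finB by (intro sum_mono2 code_in finite_PiE prod_nonneg) (auto simp: v_def)
  also have "\<dots> = (\<Sum>b\<in>?B. v b) ^ n"
    using prod_sum_PiE[of "{1..n}" "\<lambda>_. ?B" "\<lambda>_. v"] finB by simp
  also have "(\<Sum>b\<in>?B. v b) = (\<Sum>c<k. exp (a c)) * (\<Sum>y\<in>insert None (Some ` ?W). if y = None then 1 else \<tau>)"
    unfolding sum_product by (simp add: sum.cartesian_product v_def case_prod_unfold)
  also have "(\<Sum>y\<in>insert None (Some ` ?W). if y = None then 1 else \<tau>) = 1 + \<tau> * real (card ?W)"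
    using finW by (simp add: sum.reindex)
  finally show ?thesis using \<tau> by (simp add: mult_left_mono)
qed

text \<open>The two error terms of the encoding are \<open>\<tau> K\<close>, where \<open>K\<close> counts the patterns on the window, and
\<open>- \<kappa> ln \<tau>\<close>.  The first is made small by \<open>\<tau>\<close>; once \<open>\<tau>\<close> is fixed, the second is made small by \<open>\<kappa>\<close>, that
is, by \<open>\<delta>\<close>.\<close>

lemma pressure_sum_upper_bound:
  fixes G :: "('g, 'm) monoid_scheme" (structure) and a :: "nat \<Rightarrow> real"
  assumes G: "group G" and "k \<ge> 1" and \<rho>: "compatible_metric (full_shift G k) \<rho>"
    and "\<epsilon> > 0" "\<eta> > 0"
  obtains F \<delta> where "finite F" "F \<noteq> {}" "F \<subseteq> carrier G" "\<delta> > 0"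
    "\<And>n \<sigma>. n > 0 \<Longrightarrow> (\<And>s. s \<in> carrier G \<Longrightarrow> \<sigma> s permutes {1..n}) \<Longrightarrow>
      pressure_sum (\<lambda>x. a (x \<one>\<^bsub>G\<^esub>)) (full_shift G k) (left_shift G) \<rho> \<epsilon> F \<delta> n \<sigma>
        \<le> ennreal (exp (real n * (ln (\<Sum>j<k. exp (a j)) + \<eta>)))"
proof -
  interpret group G by fact
  define Z where "Z = (\<Sum>j<k. exp (a j))"
  have Z: "Z > 0" unfolding Z_def using \<open>k \<ge> 1\<close> by (intro sum_pos) (auto simp: lessThan_empty_iff)
  obtain T0 where T0: "finite T0" "T0 \<subseteq> carrier G"
    "\<And>x y. x \<in> topspace (full_shift G k) \<Longrightarrow> y \<in> topspace (full_shift G k) \<Longrightarrow>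
      \<forall>t\<in>T0. x t = y t \<Longrightarrow> \<rho> x y < \<epsilon>"
    using window_compatible_metric[OF \<rho> \<open>\<epsilon> > 0\<close>] by blast
  \<comment> \<open>Adding the identity keeps the window nonempty, as the set \<open>F\<close> derived from it must be.\<close>
  define T where "T = insert \<one> T0"
  have T: "finite T" "T \<subseteq> carrier G" "T \<noteq> {}" using T0 by (auto simp: T_def)
  obtain r where r: "r > 0" "\<And>x y. x \<in> topspace (full_shift G k) \<Longrightarrow>
      y \<in> topspace (full_shift G k) \<Longrightarrow> \<rho> x y < r \<Longrightarrow> x \<one> = y \<one>"
    using compatible_metric_separates_coordinate[OF \<rho> one_closed] by blast
  define K where "K = real (card (T \<rightarrow>\<^sub>E {..<k}))"
  define \<tau> where "\<tau> = min (1/2) (\<eta> / (2 * K))"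
  have K: "K > 0"
    using T(1) \<open>k \<ge> 1\<close> by (auto simp: K_def card_gt_0_iff PiE_eq_empty_iff lessThan_empty_iff intro!: finite_PiE)
  have \<tau>: "0 < \<tau>" "\<tau> < 1" "\<tau> * K \<le> \<eta> / 2"
  proof -
    show "0 < \<tau>" "\<tau> < 1" using K \<open>\<eta> > 0\<close> by (auto simp: \<tau>_def)
    have "\<tau> * K \<le> \<eta> / (2 * K) * K"
      using K \<open>\<eta> > 0\<close> by (intro mult_mono) (auto simp: \<tau>_def)
    also have "\<dots> = \<eta> / 2" using K by simp
    finally show "\<tau> * K \<le> \<eta> / 2" .
  qed
  define \<kappa> where "\<kappa> = \<eta> / (2 * - ln \<tau>)"
  have ln\<tau>: "ln \<tau> < 0" using \<tau> by simp
  have \<kappa>: "\<kappa> > 0" "- \<kappa> * ln \<tau> = \<eta> / 2"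
    using ln\<tau> \<open>\<eta> > 0\<close> by (auto simp: \<kappa>_def field_simps)
  define \<delta> where "\<delta> = r * sqrt (\<kappa> / real (card T))"
  have cT: "real (card T) > 0" using T by (simp add: card_gt_0_iff)
  have \<delta>: "\<delta> > 0" "real (card T) * (\<delta>\<^sup>2 / r\<^sup>2) \<le> \<kappa>"
    using r(1) \<kappa>(1) cT by (auto simp: \<delta>_def power_mult_distrib)
  show thesis
  proof (rule that[of "(\<lambda>t. inv t) ` T" \<delta>])
    fix n :: nat and \<sigma> :: "'g \<Rightarrow> nat \<Rightarrow> nat"
    assume n: "n > 0" and perm: "\<And>s. s \<in> carrier G \<Longrightarrow> \<sigma> s permutes {1..n}"
    have "\<tau> powr (- \<kappa> * n) * (Z * (1 + \<tau> * K)) ^ n \<le> exp (real n * (ln Z + \<eta>))"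
    proof -
      have "1 + \<tau> * K \<le> exp (\<eta> / 2)" using exp_ge_add_one_self[of "\<tau> * K"] \<tau>(3) by (meson exp_le_cancel_iff order_trans)
      then have "Z * (1 + \<tau> * K) \<le> exp (ln Z + \<eta> / 2)"
        using Z by (simp add: exp_add mult_left_mono)
      then have "(Z * (1 + \<tau> * K)) ^ n \<le> exp (ln Z + \<eta> / 2) ^ n"
        using Z \<tau> K by (intro power_mono) auto
      moreover have "\<tau> powr (- \<kappa> * n) = exp (real n * (\<eta> / 2))"
        unfolding \<kappa>(2)[symmetric] using \<tau>(1) by (simp add: powr_def)
      ultimately have "\<tau> powr (- \<kappa> * n) * (Z * (1 + \<tau> * K)) ^ n
          \<le> exp (real n * (\<eta> / 2)) * exp (ln Z + \<eta> / 2) ^ n"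
        by (simp add: mult_left_mono)
      also have "\<dots> = exp (real n * (ln Z + \<eta>))"
        by (simp add: exp_of_nat_mult[symmetric] exp_add[symmetric] algebra_simps)
      finally show ?thesis .
    qed
    note exp_bound = this
    have win: "\<rho> x y < \<epsilon>" if "x \<in> topspace (full_shift G k)" "y \<in> topspace (full_shift G k)"
      "\<forall>t\<in>T. x t = y t" for x y
      using T0(3)[OF that(1,2)] that(3) by (simp add: T_def)
    have \<tau>1: "\<tau> \<le> 1" using \<tau>(2) by simp
    show "pressure_sum (\<lambda>x. a (x \<one>)) (full_shift G k) (left_shift G) \<rho> \<epsilon> ((\<lambda>t. inv t) ` T) \<delta> n \<sigma>
        \<le> ennreal (exp (real n * (ln (\<Sum>j<k. exp (a j)) + \<eta>)))"
      unfolding pressure_sum_def Z_def[symmetric]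
    proof (rule SUP_least, clarify)
      fix E assume E: "finite E" "E \<subseteq> Map_sofic (full_shift G k) (left_shift G) \<rho> ((\<lambda>t. inv t) ` T) \<delta> n \<sigma>"
        "separated (rho_inf n \<rho>) \<epsilon> E"
      have "(\<Sum>\<phi>\<in>E. exp (\<Sum>j=1..n. a (\<phi> j \<one>))) \<le> \<tau> powr (- \<kappa> * n) * (Z * (1 + \<tau> * K)) ^ n"
        unfolding Z_def K_def
        by (rule pressure_sum_finite_family_le[where r=r and \<delta>=\<delta> and \<epsilon>=\<epsilon> and \<rho>=\<rho> and \<sigma>=\<sigma>];
            fact G \<tau>(1) \<tau>1 T(1,2) n \<delta> r perm win E)
      also note exp_bound
      finally show "(\<Sum>\<phi>\<in>E. ennreal (exp (\<Sum>j=1..n. a (\<phi> j \<one>)))) \<le> ennreal (exp (real n * (ln Z + \<eta>)))"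
        by (simp add: sum_ennreal ennreal_leI)
    qed
  qed (use T \<delta> in auto)
qed

section \<open>Second moment of pattern counts in a random colouring\<close>

text \<open>The weights \<open>\<Prod>j\<in>J. q (\<omega> j)\<close> make the colours of the sites independent with law \<open>q\<close>, so conditions
imposed at distinct sites \<open>\<tau> t\<close> multiply.\<close>

lemma sum_weights_cylinder:
  fixes q :: "nat \<Rightarrow> real"
  assumes J: "finite J" and q1: "(\<Sum>c<k. q c) = 1"
    and \<tau>: "inj_on \<tau> I" "\<tau> ` I \<subseteq> J" and p: "\<And>t. t \<in> I \<Longrightarrow> p t < k"
  shows "(\<Sum>\<omega>\<in>J \<rightarrow>\<^sub>E {..<k}. (\<Prod>j\<in>J. q (\<omega> j)) * of_bool (\<forall>t\<in>I. \<omega> (\<tau> t) = p t)) = (\<Prod>t\<in>I. q (p t))"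
proof -
  define B where "B j = (if j \<in> \<tau> ` I then {p (the_inv_into I \<tau> j)} else {..<k})" for j
  have B\<tau>: "B (\<tau> t) = {p t}" if "t \<in> I" for t
    using that by (simp add: B_def the_inv_into_f_f[OF \<tau>(1)])
  have eq: "{\<omega> \<in> J \<rightarrow>\<^sub>E {..<k}. \<forall>t\<in>I. \<omega> (\<tau> t) = p t} = PiE J B"
  proof (intro Set.set_eqI iffI)
    fix \<omega> assume \<omega>: "\<omega> \<in> {\<omega> \<in> J \<rightarrow>\<^sub>E {..<k}. \<forall>t\<in>I. \<omega> (\<tau> t) = p t}"
    have "\<omega> j \<in> B j" if "j \<in> J" for j
    proof (cases "j \<in> \<tau> ` I")
      case True
      then obtain t where "t \<in> I" "j = \<tau> t" by blast
      then show ?thesis using B\<tau> \<omega> by simp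
    next
      case False
      then show ?thesis using \<omega> that by (auto simp: B_def)
    qed
    then show "\<omega> \<in> PiE J B" using \<omega> by (auto simp: PiE_iff)
  next
    fix \<omega> assume \<omega>: "\<omega> \<in> PiE J B"
    have "\<omega> (\<tau> t) = p t" if "t \<in> I" for t
      using PiE_mem[OF \<omega>, of "\<tau> t"] that \<tau>(2) B\<tau>[OF that] by auto
    moreover have "\<omega> j < k" if "j \<in> J" for j
      using PiE_mem[OF \<omega> that] B\<tau> p by (cases "j \<in> \<tau> ` I") (auto simp: B_def)
    ultimately show "\<omega> \<in> {\<omega> \<in> J \<rightarrow>\<^sub>E {..<k}. \<forall>t\<in>I. \<omega> (\<tau> t) = p t}"
      using \<omega> by (auto simp: PiE_iff)
  qed
  have "(\<Sum>\<omega>\<in>J \<rightarrow>\<^sub>E {..<k}. (\<Prod>j\<in>J. q (\<omega> j)) * of_bool (\<forall>t\<in>I. \<omega> (\<tau> t) = p t))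
      = (\<Sum>\<omega>\<in>PiE J B. \<Prod>j\<in>J. q (\<omega> j))"
    unfolding eq[symmetric] using J by (subst sum.inter_filter) (auto intro!: finite_PiE sum.cong)
  also have "\<dots> = (\<Prod>j\<in>J. \<Sum>c\<in>B j. q c)"
    using J by (subst prod_sum_PiE) (auto simp: B_def)
  also have "\<dots> = (\<Prod>j\<in>\<tau> ` I. \<Sum>c\<in>B j. q c)"
    using J \<tau>(2) q1 by (intro prod.mono_neutral_right) (auto simp: B_def)
  also have "\<dots> = (\<Prod>t\<in>I. q (p t))"
    using B\<tau> by (subst prod.reindex[OF \<tau>(1)]) (auto intro!: prod.cong)
  finally show ?thesis .
qed

lemma sum_weights_eq_1:
  fixes q :: "nat \<Rightarrow> real"
  assumes "finite J" "(\<Sum>c<k. q c) = 1"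
  shows "(\<Sum>\<omega>\<in>J \<rightarrow>\<^sub>E {..<k}. \<Prod>j\<in>J. q (\<omega> j)) = 1"
  using sum_weights_cylinder[OF assms, of id "{}"] by simp

text \<open>If \<open>\<tau> j t = \<tau> l u\<close>, then \<open>j\<close>, \<open>t\<close> and \<open>u\<close> determine \<open>l\<close>.\<close>

lemma card_overlapping_pairs_le:
  fixes \<tau> :: "nat \<Rightarrow> 't \<Rightarrow> nat"
  assumes "finite T" "finite J" and inj: "\<And>t. t \<in> T \<Longrightarrow> inj_on (\<lambda>j. \<tau> j t) J"
  shows "card {(j, l) \<in> J \<times> J. \<tau> j ` T \<inter> \<tau> l ` T \<noteq> {}} \<le> card T ^ 2 * card J"
proof -
  have "{(j, l) \<in> J \<times> J. \<tau> j ` T \<inter> \<tau> l ` T \<noteq> {}}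
      \<subseteq> (\<Union>(t, u)\<in>T \<times> T. {(j, l) \<in> J \<times> J. \<tau> j t = \<tau> l u})" by fastforce
  then have "card {(j, l) \<in> J \<times> J. \<tau> j ` T \<inter> \<tau> l ` T \<noteq> {}}
      \<le> card (\<Union>(t, u)\<in>T \<times> T. {(j, l) \<in> J \<times> J. \<tau> j t = \<tau> l u})"
    using assms(1,2) by (intro card_mono finite_UN_I) (auto intro: finite_subset[of _ "J \<times> J"])
  also have "\<dots> \<le> (\<Sum>(t, u)\<in>T \<times> T. card {(j, l) \<in> J \<times> J. \<tau> j t = \<tau> l u})"
    using card_UN_le[of "T \<times> T" "\<lambda>(t, u). {(j, l) \<in> J \<times> J. \<tau> j t = \<tau> l u}"] assms(1)
    by (simp add: case_prod_unfold)
  also have "\<dots> \<le> (\<Sum>(t, u)\<in>T \<times> T. card J)"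
  proof (intro sum_mono, clarify)
    fix t u assume tu: "t \<in> T" "u \<in> T"
    show "card {(j, l) \<in> J \<times> J. \<tau> j t = \<tau> l u} \<le> card J"
      by (rule card_inj_on_le[of fst]) (use inj[OF tu(2)] assms(2) in \<open>auto simp: inj_on_def\<close>)
  qed
  also have "\<dots> = card T ^ 2 * card J"
    by (simp add: card_cartesian_product power2_eq_square case_prod_unfold)
  finally show ?thesis .
qed

text \<open>Let \<open>m\<close> be the product of the \<open>q (p t)\<close>, and expand the square into expectations of \<open>(X j - m) (X l - m)\<close>,
where \<open>X j\<close> indicates that the pattern \<open>p\<close> occurs at the site \<open>j\<close>.  If the windows \<open>\<tau> j ` T\<close> and
\<open>\<tau> l ` T\<close> are injective images of \<open>T\<close> and disjoint, the expectation vanishes; otherwise it is at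
most 1, and the bound counts the pairs of this second kind.\<close>

lemma pattern_count_second_moment:
  fixes q :: "nat \<Rightarrow> real" and \<tau> :: "nat \<Rightarrow> 't \<Rightarrow> nat"
  assumes q: "(\<Sum>c<k. q c) = 1" "\<And>c. c < k \<Longrightarrow> q c \<ge> 0"
    and T: "finite T" and J: "finite J" and p: "\<And>t. t \<in> T \<Longrightarrow> p t < k"
    and \<tau>: "\<And>t. t \<in> T \<Longrightarrow> inj_on (\<lambda>j. \<tau> j t) J" "\<And>j t. j \<in> J \<Longrightarrow> t \<in> T \<Longrightarrow> \<tau> j t \<in> J"
  shows "(\<Sum>\<omega>\<in>J \<rightarrow>\<^sub>E {..<k}. (\<Prod>j\<in>J. q (\<omega> j)) *
      (real (card {j \<in> J. \<forall>t\<in>T. \<omega> (\<tau> j t) = p t}) - real (card J) * (\<Prod>t\<in>T. q (p t)))\<^sup>2)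
    \<le> real (2 * card {j \<in> J. \<not> inj_on (\<tau> j) T} * card J + card T ^ 2 * card J)"
proof -
  let ?\<Omega> = "J \<rightarrow>\<^sub>E {..<k}"
  define m where "m = (\<Prod>t\<in>T. q (p t))"
  define w where "w \<omega> = (\<Prod>j\<in>J. q (\<omega> j))" for \<omega>
  define X where "X j \<omega> = (of_bool (\<forall>t\<in>T. \<omega> (\<tau> j t) = p t) :: real)" for j \<omega>
  define S where "S j l = (\<Sum>\<omega>\<in>?\<Omega>. w \<omega> * ((X j \<omega> - m) * (X l \<omega> - m)))" for j l
  have w0: "w \<omega> \<ge> 0" if "\<omega> \<in> ?\<Omega>" for \<omega>
    unfolding w_def using that by (intro prod_nonneg q(2)) auto
  have w1: "(\<Sum>\<omega>\<in>?\<Omega>. w \<omega>) = 1"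
    unfolding w_def by (rule sum_weights_eq_1[OF J q(1)])
  have q_le: "q c \<le> 1" if "c < k" for c
    using member_le_sum[of c "{..<k}" q] q that by auto
  have m: "0 \<le> m" "m \<le> 1"
    unfolding m_def using q p q_le by (auto intro!: prod_nonneg prod_le_1)
  have S_le: "S j l \<le> 1" for j l
  proof -
    have "w \<omega> * ((X j \<omega> - m) * (X l \<omega> - m)) \<le> w \<omega> * 1" if "\<omega> \<in> ?\<Omega>" for \<omega>
    proof (intro mult_left_mono w0 that)
      have "\<bar>X i \<omega> - m\<bar> \<le> 1" for i using m by (auto simp: X_def)
      then have "\<bar>X j \<omega> - m\<bar> * \<bar>X l \<omega> - m\<bar> \<le> 1 * 1" by (intro mult_mono) auto
      then show "(X j \<omega> - m) * (X l \<omega> - m) \<le> 1" by (simp add: abs_mult[symmetric] abs_le_iff)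
    qed
    then show ?thesis unfolding S_def using w1 sum_mono by (metis (no_types, lifting) mult.right_neutral)
  qed
  have S_zero: "S j l = 0" if jl: "j \<in> J" "l \<in> J" "inj_on (\<tau> j) T" "inj_on (\<tau> l) T" "\<tau> j ` T \<inter> \<tau> l ` T = {}" for j l
  proof -
    have E1: "(\<Sum>\<omega>\<in>?\<Omega>. w \<omega> * X i \<omega>) = m" if "i \<in> J" "inj_on (\<tau> i) T" for i
      unfolding w_def X_def m_def using sum_weights_cylinder[OF J q(1) that(2), of p] \<tau>(2) that(1) p by auto
    \<comment> \<open>Two windows carrying the same pattern form one pattern on the disjoint sum of two copies of \<open>T\<close>.\<close>
    have E2: "(\<Sum>\<omega>\<in>?\<Omega>. w \<omega> * (X j \<omega> * X l \<omega>)) = m * m"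
    proof -
      have "(\<Sum>\<omega>\<in>?\<Omega>. w \<omega> * (X j \<omega> * X l \<omega>)) = (\<Sum>\<omega>\<in>?\<Omega>. (\<Prod>j\<in>J. q (\<omega> j)) *
          of_bool (\<forall>t\<in>T <+> T. \<omega> (case_sum (\<tau> j) (\<tau> l) t) = case_sum p p t))"
        unfolding w_def X_def by (intro sum.cong refl arg_cong2[where f="(*)"]) (auto simp: ball_Un Plus_def)
      also have "\<dots> = (\<Prod>t\<in>T <+> T. q (case_sum p p t))"
      proof (rule sum_weights_cylinder[OF J q(1)])
        show "inj_on (case_sum (\<tau> j) (\<tau> l)) (T <+> T)"
        proof (rule inj_onI)
          fix t u assume "t \<in> T <+> T" "u \<in> T <+> T" "case_sum (\<tau> j) (\<tau> l) t = case_sum (\<tau> j) (\<tau> l) u"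
          then show "t = u"
            using jl(3-5) by (elim PlusE) (auto dest: inj_onD)
        qed
        show "case_sum (\<tau> j) (\<tau> l) ` (T <+> T) \<subseteq> J" using \<tau>(2) jl(1,2) by auto
      qed (use p in auto)
      also have "\<dots> = m * m" using T by (simp add: prod.Plus m_def o_def)
      finally show ?thesis .
    qed
    have "S j l = (\<Sum>\<omega>\<in>?\<Omega>. w \<omega> * (X j \<omega> * X l \<omega>) - m * (w \<omega> * X j \<omega>) - m * (w \<omega> * X l \<omega>) + m * m * w \<omega>)"
      unfolding S_def by (intro sum.cong) (auto simp: algebra_simps)
    also have "\<dots> = 0"
      using E1[OF jl(1,3)] E1[OF jl(2,4)] E2 w1
      by (simp add: sum.distrib sum_subtractf sum_distrib_left[symmetric])
    finally show ?thesis .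
  qed
  let ?b = "{j \<in> J. \<not> inj_on (\<tau> j) T}"
  let ?P = "?b \<times> J \<union> J \<times> ?b \<union> {(j, l) \<in> J \<times> J. \<tau> j ` T \<inter> \<tau> l ` T \<noteq> {}}"
  have finP: "finite ?P" using J by (auto intro: finite_subset[of _ "J \<times> J"])
  have "(\<Sum>\<omega>\<in>?\<Omega>. w \<omega> * (real (card {j \<in> J. \<forall>t\<in>T. \<omega> (\<tau> j t) = p t}) - real (card J) * m)\<^sup>2)
      = (\<Sum>\<omega>\<in>?\<Omega>. \<Sum>(j, l)\<in>J \<times> J. w \<omega> * ((X j \<omega> - m) * (X l \<omega> - m)))"
  proof (intro sum.cong refl)
    fix \<omega>
    have "real (card {j \<in> J. \<forall>t\<in>T. \<omega> (\<tau> j t) = p t}) - real (card J) * m = (\<Sum>j\<in>J. X j \<omega> - m)"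
      using J by (simp add: X_def sum_subtractf Int_def)
    moreover have "(\<Sum>j\<in>J. X j \<omega> - m)\<^sup>2 = (\<Sum>(j, l)\<in>J \<times> J. (X j \<omega> - m) * (X l \<omega> - m))"
      unfolding power2_eq_square sum_product sum.cartesian_product ..
    ultimately show "w \<omega> * (real (card {j \<in> J. \<forall>t\<in>T. \<omega> (\<tau> j t) = p t}) - real (card J) * m)\<^sup>2
        = (\<Sum>(j, l)\<in>J \<times> J. w \<omega> * ((X j \<omega> - m) * (X l \<omega> - m)))"
      by (simp add: sum_distrib_left case_prod_unfold)
  qed
  also have "\<dots> = (\<Sum>(j, l)\<in>J \<times> J. S j l)"
    unfolding S_def case_prod_unfold by (rule sum.swap)
  also have "\<dots> = (\<Sum>(j, l)\<in>?P. S j l)"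
    using J by (intro sum.mono_neutral_right) (auto intro!: S_zero)
  also have "\<dots> \<le> (\<Sum>(j, l)\<in>?P. 1)" by (intro sum_mono) (auto intro: S_le)
  also have "\<dots> = real (card ?P)" by (simp add: case_prod_unfold)
  also have "\<dots> \<le> real (card (?b \<times> J) + card (J \<times> ?b) + card {(j, l) \<in> J \<times> J. \<tau> j ` T \<inter> \<tau> l ` T \<noteq> {}})"
    by (intro of_nat_mono order_trans[OF card_Un_le] add_mono card_Un_le order_refl)
  also have "\<dots> \<le> real (2 * card ?b * card J + card T ^ 2 * card J)"
    using card_overlapping_pairs_le[OF T J \<tau>(1)] by (intro of_nat_mono) (simp add: card_cartesian_product)
  finally show ?thesis by (simp add: w_def m_def)
qed

text \<open>Chebyshev's inequality.  The bound is small when \<open>J\<close> is large and the windows are injective images of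
\<open>T\<close> at most sites, which is what a sofic approximation provides.\<close>

lemma pattern_frequency_concentration:
  fixes q :: "nat \<Rightarrow> real" and \<tau> :: "nat \<Rightarrow> 't \<Rightarrow> nat"
  assumes q: "(\<Sum>c<k. q c) = 1" "\<And>c. c < k \<Longrightarrow> q c \<ge> 0"
    and T: "finite T" and J: "finite J" "J \<noteq> {}" and p: "\<And>t. t \<in> T \<Longrightarrow> p t < k" and "\<xi> > 0"
    and \<tau>: "\<And>t. t \<in> T \<Longrightarrow> inj_on (\<lambda>j. \<tau> j t) J" "\<And>j t. j \<in> J \<Longrightarrow> t \<in> T \<Longrightarrow> \<tau> j t \<in> J"
  shows "(\<Sum>\<omega>\<in>{\<omega> \<in> J \<rightarrow>\<^sub>E {..<k}. \<bar>real (card {j \<in> J. \<forall>t\<in>T. \<omega> (\<tau> j t) = p t}) / real (card J)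
        - (\<Prod>t\<in>T. q (p t))\<bar> \<ge> \<xi>}. \<Prod>j\<in>J. q (\<omega> j))
    \<le> (2 * (real (card {j \<in> J. \<not> inj_on (\<tau> j) T}) / real (card J))
        + real (card T ^ 2) / real (card J)) / \<xi>\<^sup>2"
proof -
  let ?\<Omega> = "J \<rightarrow>\<^sub>E {..<k}"
  define n where "n = real (card J)"
  have n: "n > 0" using J by (simp add: n_def card_gt_0_iff)
  define m where "m = (\<Prod>t\<in>T. q (p t))"
  define N where "N \<omega> = real (card {j \<in> J. \<forall>t\<in>T. \<omega> (\<tau> j t) = p t})" for \<omega>
  define b where "b = real (card {j \<in> J. \<not> inj_on (\<tau> j) T})"
  define w where "w \<omega> = (\<Prod>j\<in>J. q (\<omega> j))" for \<omega>
  have w0: "w \<omega> \<ge> 0" if "\<omega> \<in> ?\<Omega>" for \<omega>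
    unfolding w_def using that by (intro prod_nonneg q(2)) auto
  have fin: "finite ?\<Omega>" using J by (intro finite_PiE) auto
  have "(\<Sum>\<omega>\<in>{\<omega> \<in> ?\<Omega>. \<bar>N \<omega> / n - m\<bar> \<ge> \<xi>}. w \<omega>) * (n * \<xi>)\<^sup>2
      \<le> (\<Sum>\<omega>\<in>{\<omega> \<in> ?\<Omega>. \<bar>N \<omega> / n - m\<bar> \<ge> \<xi>}. w \<omega> * (N \<omega> - n * m)\<^sup>2)"
    unfolding sum_distrib_right
  proof (intro sum_mono mult_left_mono)
    fix \<omega> assume \<omega>: "\<omega> \<in> {\<omega> \<in> ?\<Omega>. \<bar>N \<omega> / n - m\<bar> \<ge> \<xi>}"
    have "N \<omega> - n * m = n * (N \<omega> / n - m)" using n by (simp add: field_simps)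
    then have "\<bar>N \<omega> - n * m\<bar> \<ge> \<bar>n * \<xi>\<bar>" using \<omega> n \<open>\<xi> > 0\<close> by (simp add: abs_mult)
    then show "(n * \<xi>)\<^sup>2 \<le> (N \<omega> - n * m)\<^sup>2" by (simp add: abs_le_square_iff)
    show "0 \<le> w \<omega>" using \<omega> w0 by simp
  qed
  also have "\<dots> \<le> (\<Sum>\<omega>\<in>?\<Omega>. w \<omega> * (N \<omega> - n * m)\<^sup>2)"
    using fin w0 by (intro sum_mono2) auto
  also have "\<dots> \<le> 2 * b * n + real (card T ^ 2) * n"
    using pattern_count_second_moment[OF q T J(1) p \<tau>] unfolding w_def N_def n_def m_def b_def by simp
  finally have "(\<Sum>\<omega>\<in>{\<omega> \<in> ?\<Omega>. \<bar>N \<omega> / n - m\<bar> \<ge> \<xi>}. w \<omega>)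
      \<le> (2 * b * n + real (card T ^ 2) * n) / (n * \<xi>)\<^sup>2"
    using n \<open>\<xi> > 0\<close> by (simp add: pos_le_divide_eq)
  also have "\<dots> = (2 * (b / n) + real (card T ^ 2) / n) / \<xi>\<^sup>2"
    using n \<open>\<xi> > 0\<close> by (simp add: field_simps power2_eq_square)
  finally show ?thesis by (simp add: w_def N_def n_def m_def b_def)
qed

section \<open>Product measures on the full shift\<close>

text \<open>There are only countably many cylinders, and every open set is the union of the cylinders it contains.\<close>

lemma sets_PiM_full_shift:
  assumes count: "countable (carrier G)" and p: "sets p = Pow {..<k}"
  shows "sets (Pi\<^sub>M (carrier G) (\<lambda>_. p))
    = sigma_sets (topspace (full_shift G k)) {U. openin (full_shift G k) U}"
proof (rule Set.equalityI)
  let ?X = "topspace (full_shift G k)"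
  let ?M = "Pi\<^sub>M (carrier G) (\<lambda>_. p)"
  have space_p: "space p = {..<k}" using sets_eq_imp_space_eq[of p "count_space {..<k}"] p by simp
  have space: "space ?M = ?X" by (simp add: space_PiM space_p topspace_full_shift)
  show "sets ?M \<subseteq> sigma_sets ?X {U. openin (full_shift G k) U}"
  proof -
    have gen: "{f \<in> \<Pi>\<^sub>E i\<in>carrier G. space p. f i \<in> A} \<in> {U. openin (full_shift G k) U}"
      if "i \<in> carrier G" "A \<in> sets p" for i A
    proof -
      have "openin (full_shift G k) {x \<in> ?X. x i \<in> A}"
        unfolding full_shift_def
        by (rule openin_continuous_map_preimage[OF continuous_map_product_coordinates[OF that(1)]])
          (use that p in auto)
      then show ?thesis by (simp add: space_p topspace_full_shift)
    qed
    have "sigma_sets (\<Pi>\<^sub>E i\<in>carrier G. space p)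
        {{f \<in> \<Pi>\<^sub>E i\<in>carrier G. space p. f i \<in> A} | i A. i \<in> carrier G \<and> A \<in> sets p}
      \<subseteq> sigma_sets (\<Pi>\<^sub>E i\<in>carrier G. space p) {U. openin (full_shift G k) U}"
      by (rule sigma_sets_subseteq) (use gen in blast)
    then show ?thesis unfolding sets_PiM_single by (simp add: space_p topspace_full_shift)
  qed
  show "sigma_sets ?X {U. openin (full_shift G k) U} \<subseteq> sets ?M"
  proof -
    define C where "C T w = {x \<in> ?X. \<forall>t\<in>T. x t = w t}" for T and w :: "'a \<Rightarrow> nat"
    have C_sets: "C T w \<in> sets ?M" if "finite T" "T \<subseteq> carrier G" for T w
    proof -
      have "C T w = {x \<in> space ?M. \<forall>t\<in>T. x t \<in> {w t} \<inter> {..<k}}"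
        using that unfolding C_def space by (auto simp: topspace_full_shift PiE_iff)
      also have "\<dots> \<in> sets ?M"
      proof (rule sets.sets_Collect_finite_All[of T])
        fix t assume "t \<in> T"
        then have "(\<lambda>x. x t) \<in> measurable ?M p" using that by (intro measurable_component_singleton) auto
        then have "(\<lambda>x. x t) -` ({w t} \<inter> {..<k}) \<inter> space ?M \<in> sets ?M"
          by (rule measurable_sets) (auto simp: p)
        moreover have "(\<lambda>x. x t) -` ({w t} \<inter> {..<k}) \<inter> space ?M = {x \<in> space ?M. x t \<in> {w t} \<inter> {..<k}}"
          by blast
        ultimately show "{x \<in> space ?M. x t \<in> {w t} \<inter> {..<k}} \<in> sets ?M" by simp
      qed (use that in auto)
      finally show ?thesis .
    qed
    have "U \<in> sets ?M" if U: "openin (full_shift G k) U" for U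
    proof -
      let ?I = "SIGMA T:{T. finite T \<and> T \<subseteq> carrier G}. {w \<in> T \<rightarrow>\<^sub>E {..<k}. C T w \<subseteq> U}"
      have "countable (SIGMA T:{T. finite T \<and> T \<subseteq> carrier G}. T \<rightarrow>\<^sub>E {..<k})"
        using count by (intro countable_SIGMA countable_Collect_finite_subset)
          (auto intro!: countable_finite finite_PiE)
      then have "countable ?I" by (rule countable_subset[rotated]) auto
      moreover have "U = (\<Union>(T, w)\<in>?I. C T w)"
      proof (rule Set.equalityI)
        show "U \<subseteq> (\<Union>(T, w)\<in>?I. C T w)"
        proof
          fix x assume x: "x \<in> U"
          obtain T where T: "finite T" "T \<subseteq> carrier G" "\<And>y. y \<in> ?X \<Longrightarrow> \<forall>t\<in>T. y t = x t \<Longrightarrow> y \<in> U"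
            using open_contains_cylinder[OF U x] by blast
          have xX: "x \<in> ?X" using openin_subset[OF U] x by blast
          have CT: "C T (restrict x T) = {y \<in> ?X. \<forall>t\<in>T. y t = x t}" by (auto simp: C_def)
          have "restrict x T \<in> T \<rightarrow>\<^sub>E {..<k}" using xX T(2) by (auto simp: topspace_full_shift PiE_iff)
          moreover have "C T (restrict x T) \<subseteq> U" using T(3) CT by blast
          moreover have "x \<in> C T (restrict x T)" using xX CT by blast
          ultimately have "(T, restrict x T) \<in> ?I" "x \<in> C T (restrict x T)" using T(1,2) by auto
          then show "x \<in> (\<Union>(T, w)\<in>?I. C T w)" by blast
        qed
      qed auto
      moreover have "(\<Union>i\<in>?I. case i of (T, w) \<Rightarrow> C T w) \<in> sets ?M"
        by (rule sets.countable_UN'[OF \<open>countable ?I\<close>]) (use C_sets in auto)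
      ultimately show ?thesis by simp
    qed
    then show ?thesis unfolding space[symmetric] by (intro sets.sigma_sets_subset) auto
  qed
qed

context
  fixes G :: "('g, 'm) monoid_scheme" (structure) and k :: nat and p :: "nat measure"
  assumes count: "countable (carrier G)" and prob: "prob_space p" and sets_p: "sets p = Pow {..<k}"
begin

lemma space_coin: "space p = {..<k}"
  using sets_eq_imp_space_eq[of p "count_space {..<k}"] sets_p by simp

lemma space_PiM_full_shift: "space (Pi\<^sub>M (carrier G) (\<lambda>_. p)) = topspace (full_shift G k)"
  by (simp add: space_PiM space_coin topspace_full_shift)

lemma borel_measurable_PiM_full_shift:
  assumes "continuous_map (full_shift G k) euclideanreal g"
  shows "g \<in> borel_measurable (Pi\<^sub>M (carrier G) (\<lambda>_. p))"
proof (rule borel_measurableI)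
  fix S :: "real set" assume "open S"
  then have "openin (full_shift G k) {x \<in> topspace (full_shift G k). g x \<in> S}"
    using openin_continuous_map_preimage[OF assms, of S] by simp
  moreover have "g -` S \<inter> space (Pi\<^sub>M (carrier G) (\<lambda>_. p)) = {x \<in> topspace (full_shift G k). g x \<in> S}"
    by (auto simp: space_PiM_full_shift)
  ultimately show "g -` S \<inter> space (Pi\<^sub>M (carrier G) (\<lambda>_. p)) \<in> sets (Pi\<^sub>M (carrier G) (\<lambda>_. p))"
    by (simp add: sets_PiM_full_shift[OF count sets_p])
qed

lemma cylinder_PiM_full_shift:
  assumes T: "finite T" "T \<subseteq> carrier G" and w: "\<And>t. t \<in> T \<Longrightarrow> w t < k"
  defines "C \<equiv> {x \<in> topspace (full_shift G k). \<forall>t\<in>T. x t = w t}"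
  shows "C \<in> sets (Pi\<^sub>M (carrier G) (\<lambda>_. p))"
    and "measure (Pi\<^sub>M (carrier G) (\<lambda>_. p)) C = (\<Prod>t\<in>T. measure p {w t})"
proof -
  let ?M = "Pi\<^sub>M (carrier G) (\<lambda>_. p)"
  interpret p: prob_space p by (rule prob)
  show "C \<in> sets ?M"
    unfolding sets_PiM_full_shift[OF count sets_p] C_def using openin_cylinder[OF T, of k w] by auto
  have "C = prod_emb (carrier G) (\<lambda>_. p) T (\<Pi>\<^sub>E t\<in>T. {w t})"
    unfolding C_def prod_emb_def space_PiM[symmetric] space_PiM_full_shift
    by (auto simp: PiE_iff extensional_def restrict_def space_PiM space_coin topspace_full_shift)
  moreover have "emeasure ?M (prod_emb (carrier G) (\<lambda>_. p) T (\<Pi>\<^sub>E t\<in>T. {w t})) = (\<Prod>t\<in>T. emeasure p {w t})"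
    by (rule emeasure_PiM_emb[OF prob T(2,1)]) (use w sets_p in auto)
  ultimately have "emeasure ?M C = ennreal (\<Prod>t\<in>T. measure p {w t})"
    by (simp add: p.emeasure_eq_measure prod_ennreal)
  then show "measure ?M C = (\<Prod>t\<in>T. measure p {w t})"
    by (simp add: measure_def prod_nonneg)
qed

text \<open>A shift permutes the coordinates, and all factors of the product measure are equal.\<close>

lemma invariant_borel_prob_PiM:
  assumes "group G"
  shows "invariant_borel_prob G (full_shift G k) (left_shift G) (Pi\<^sub>M (carrier G) (\<lambda>_. p))"
proof -
  interpret group G by fact
  let ?M = "Pi\<^sub>M (carrier G) (\<lambda>_. p)"
  have shift: "left_shift G s \<in> measurable ?M ?M \<and> distr ?M ?M (left_shift G s) = ?M"
    if s: "s \<in> carrier G" for s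
  proof
    have eq: "left_shift G s = (\<lambda>x. \<lambda>t\<in>carrier G. x (inv s \<otimes> t))"
      by (simp add: left_shift_def fun_eq_iff)
    show "left_shift G s \<in> measurable ?M ?M"
      unfolding eq using s by (intro measurable_restrict measurable_component_singleton) auto
    show "distr ?M ?M (left_shift G s) = ?M"
      unfolding eq using s by (intro distr_PiM_reindex[OF prob]) (auto simp: inj_on_def)
  qed
  show ?thesis
    unfolding invariant_borel_prob_def
    using prob_space_PiM[OF prob] shift sets_PiM_full_shift[OF count sets_p] by blast
qed

text \<open>The sum is the integral of the function that replaces each point by the representative \<open>x w\<close> of its
pattern \<open>w\<close> on \<open>T\<close>, which moves the value of \<open>g\<close> by less than \<open>\<epsilon>\<close>.\<close>

lemma integral_cylinder_approximation:
  assumes "k \<ge> 1" and g: "continuous_map (full_shift G k) euclideanreal g"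
    and T: "finite T" "T \<subseteq> carrier G"
    and x: "\<And>w. w \<in> T \<rightarrow>\<^sub>E {..<k} \<Longrightarrow> x w \<in> topspace (full_shift G k)"
      "\<And>w t. w \<in> T \<rightarrow>\<^sub>E {..<k} \<Longrightarrow> t \<in> T \<Longrightarrow> x w t = w t"
    and win: "\<And>y z. y \<in> topspace (full_shift G k) \<Longrightarrow> z \<in> topspace (full_shift G k) \<Longrightarrow>
      \<forall>t\<in>T. y t = z t \<Longrightarrow> \<bar>g y - g z\<bar> < \<epsilon>"
  shows "\<bar>(\<Sum>w\<in>T \<rightarrow>\<^sub>E {..<k}. g (x w) * (\<Prod>t\<in>T. measure p {w t})) - integral\<^sup>L (Pi\<^sub>M (carrier G) (\<lambda>_. p)) g\<bar> \<le> \<epsilon>"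
proof -
  let ?M = "Pi\<^sub>M (carrier G) (\<lambda>_. p)"
  let ?X = "topspace (full_shift G k)"
  let ?W = "T \<rightarrow>\<^sub>E {..<k}"
  interpret M: prob_space ?M by (rule prob_space_PiM[OF prob])
  have finW: "finite ?W" using T(1) by (intro finite_PiE) auto
  define C where "C w = {y \<in> ?X. \<forall>t\<in>T. y t = w t}" for w
  have C: "C w \<in> sets ?M" "measure ?M (C w) = (\<Prod>t\<in>T. measure p {w t})" if "w \<in> ?W" for w
    unfolding C_def using that by (intro cylinder_PiM_full_shift[OF T]; auto)+
  define h where "h y = (\<Sum>w\<in>?W. g (x w) * indicator (C w) y)" for y
  have h_int: "integrable ?M h"
    unfolding h_def using C by (intro Bochner_Integration.integrable_sum integrable_mult_right integrable_real_indicator)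
      (auto simp: M.emeasure_eq_measure)
  have "integral\<^sup>L ?M h = (\<Sum>w\<in>?W. integral\<^sup>L ?M (\<lambda>y. g (x w) * indicator (C w) y))"
    unfolding h_def using C
    by (intro Bochner_Integration.integral_sum integrable_mult_right integrable_real_indicator)
      (auto simp: M.emeasure_eq_measure)
  also have "\<dots> = (\<Sum>w\<in>?W. g (x w) * (\<Prod>t\<in>T. measure p {w t}))"
    using C by (intro sum.cong) auto
  finally have h_eq: "integral\<^sup>L ?M h = (\<Sum>w\<in>?W. g (x w) * (\<Prod>t\<in>T. measure p {w t}))" .
  have close: "\<bar>h y - g y\<bar> \<le> \<epsilon>" if y: "y \<in> space ?M" for y
  proof -
    have yX: "y \<in> ?X" using y space_PiM_full_shift by simp
    have rW: "restrict y T \<in> ?W" using yX T(2) by (auto simp: topspace_full_shift PiE_iff)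
    have "indicator (C w) y = (of_bool (w = restrict y T) :: real)" if "w \<in> ?W" for w
    proof (cases "y \<in> C w")
      case True
      then have "w = restrict y T" using that by (intro PiE_ext[OF that rW]) (auto simp: C_def)
      then show ?thesis using True by simp
    next
      case False
      then have "w \<noteq> restrict y T" using yX by (auto simp: C_def)
      then show ?thesis using False by simp
    qed
    then have "h y = (\<Sum>w\<in>?W. g (x w) * of_bool (w = restrict y T))" by (simp add: h_def)
    also have "\<dots> = g (x (restrict y T))" using finW rW by (simp add: of_bool_def if_distrib sum.delta cong: if_cong)
    finally have "h y = g (x (restrict y T))" .
    moreover have "\<bar>g (x (restrict y T)) - g y\<bar> < \<epsilon>"
      using x[OF rW] yX by (intro win) auto
    ultimately show ?thesis by simp
  qed
  have g_meas: "g \<in> borel_measurable ?M" by (rule borel_measurable_PiM_full_shift[OF g])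
  have g_int: "integrable ?M g"
  proof (rule M.integrable_const_bound)
    show "AE y in ?M. norm (g y) \<le> (\<Sum>w\<in>?W. \<bar>g (x w)\<bar>) + \<epsilon>"
    proof (rule AE_I2)
      fix y assume y: "y \<in> space ?M"
      have "\<bar>h y\<bar> \<le> (\<Sum>w\<in>?W. \<bar>g (x w) * indicator (C w) y\<bar>)" unfolding h_def by (rule sum_abs)
      also have "\<dots> \<le> (\<Sum>w\<in>?W. \<bar>g (x w)\<bar>)" by (intro sum_mono) (auto simp: indicator_def)
      finally show "norm (g y) \<le> (\<Sum>w\<in>?W. \<bar>g (x w)\<bar>) + \<epsilon>" using close[OF y] by simp
    qed
  qed (rule g_meas)
  have "\<bar>integral\<^sup>L ?M h - integral\<^sup>L ?M g\<bar> = \<bar>integral\<^sup>L ?M (\<lambda>y. h y - g y)\<bar>"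
    using h_int g_int by simp
  also have "\<dots> \<le> integral\<^sup>L ?M (\<lambda>y. \<bar>h y - g y\<bar>)" by (rule integral_abs_bound)
  also have "\<dots> \<le> integral\<^sup>L ?M (\<lambda>y. \<epsilon>)"
    using h_int g_int close by (intro integral_mono) auto
  also have "\<dots> = \<epsilon>" by (simp add: M.prob_space)
  finally show ?thesis by (simp add: h_eq)
qed

text \<open>Convergence of the empirical measure to the product measure can be tested on the patterns of one finite
window: both the average and the integral of \<open>g\<close> are close to the sum of \<open>g\<close> over representatives of the
patterns, weighted with empirical frequencies in one case and with probabilities in the other.\<close>

lemma empirical_average_close_to_integral:
  assumes "k \<ge> 1" and g: "continuous_map (full_shift G k) euclideanreal g" and "\<delta> > 0"
  obtains T \<xi> where "finite T" "T \<subseteq> carrier G" "\<xi> > 0"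
    "\<And>n \<psi>. n > 0 \<Longrightarrow> (\<And>j. j \<in> {1..n} \<Longrightarrow> \<psi> j \<in> topspace (full_shift G k)) \<Longrightarrow>
      (\<And>w. w \<in> T \<rightarrow>\<^sub>E {..<k} \<Longrightarrow> \<bar>real (card {j \<in> {1..n}. \<forall>t\<in>T. \<psi> j t = w t}) / real n
          - (\<Prod>t\<in>T. measure p {w t})\<bar> < \<xi>) \<Longrightarrow>
      \<bar>(1 / real n) * (\<Sum>j=1..n. g (\<psi> j)) - integral\<^sup>L (Pi\<^sub>M (carrier G) (\<lambda>_. p)) g\<bar> < \<delta>"
proof -
  let ?X = "topspace (full_shift G k)"
  have "\<delta>/4 > 0" using \<open>\<delta> > 0\<close> by simp
  obtain T where T: "finite T" "T \<subseteq> carrier G"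
    and win: "\<And>x y. x \<in> ?X \<Longrightarrow> y \<in> ?X \<Longrightarrow> \<forall>t\<in>T. x t = y t \<Longrightarrow> \<bar>g x - g y\<bar> < \<delta>/4"
    using window_continuous_map[OF g \<open>\<delta>/4 > 0\<close>] by blast
  let ?W = "T \<rightarrow>\<^sub>E {..<k}"
  have finW: "finite ?W" using T(1) by (intro finite_PiE) auto
  \<comment> \<open>Outside the window any colour will do; \<open>0\<close> is one because \<open>k \<ge> 1\<close>.\<close>
  define x where "x w = (\<lambda>t\<in>carrier G. if t \<in> T then w t else 0)" for w :: "'g \<Rightarrow> nat"
  have x: "x w \<in> ?X" "\<And>t. t \<in> T \<Longrightarrow> x w t = w t" if "w \<in> ?W" for w
    using that T(2) \<open>k \<ge> 1\<close> by (auto simp: x_def topspace_full_shift PiE_iff)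
  define B where "B = (\<Sum>w\<in>?W. \<bar>g (x w)\<bar>) + 1"
  have "(\<Sum>w\<in>?W. \<bar>g (x w)\<bar>) \<ge> 0" by (intro sum_nonneg) simp
  then have B: "B > 0" unfolding B_def by linarith
  define \<xi> where "\<xi> = \<delta> / (4 * B)"
  have \<xi>: "\<xi> > 0" "B * \<xi> = \<delta>/4" using B \<open>\<delta> > 0\<close> by (simp_all add: \<xi>_def)
  show thesis
  proof (rule that[OF T \<xi>(1)])
    fix n :: nat and \<psi> :: "nat \<Rightarrow> 'g \<Rightarrow> nat"
    assume n: "n > 0" and \<psi>: "\<And>j. j \<in> {1..n} \<Longrightarrow> \<psi> j \<in> ?X"
      and freq: "\<And>w. w \<in> ?W \<Longrightarrow> \<bar>real (card {j \<in> {1..n}. \<forall>t\<in>T. \<psi> j t = w t}) / real n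
          - (\<Prod>t\<in>T. measure p {w t})\<bar> < \<xi>"
    define N where "N w = real (card {j \<in> {1..n}. \<forall>t\<in>T. \<psi> j t = w t})" for w
    have rW: "restrict (\<psi> j) T \<in> ?W" if "j \<in> {1..n}" for j
      using \<psi>[OF that] T(2) by (auto simp: topspace_full_shift PiE_iff)
    have fib: "{j \<in> {1..n}. restrict (\<psi> j) T = w} = {j \<in> {1..n}. \<forall>t\<in>T. \<psi> j t = w t}" if "w \<in> ?W" for w
    proof (intro Collect_cong conj_cong refl iffI)
      fix j assume "j \<in> {1..n}" "\<forall>t\<in>T. \<psi> j t = w t"
      then show "restrict (\<psi> j) T = w" by (intro PiE_ext[OF rW that]) simp_all
    qed auto
    have "(\<Sum>j=1..n. g (x (restrict (\<psi> j) T)))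
        = (\<Sum>w\<in>?W. \<Sum>j\<in>{j \<in> {1..n}. restrict (\<psi> j) T = w}. g (x (restrict (\<psi> j) T)))"
      by (rule sum.group[symmetric, OF _ finW image_subsetI[OF rW]]) simp_all
    also have "\<dots> = (\<Sum>w\<in>?W. g (x w) * N w)"
    proof (intro sum.cong refl)
      fix w assume w: "w \<in> ?W"
      have "(\<Sum>j\<in>{j \<in> {1..n}. restrict (\<psi> j) T = w}. g (x (restrict (\<psi> j) T)))
          = (\<Sum>j\<in>{j \<in> {1..n}. restrict (\<psi> j) T = w}. g (x w))"
        by (intro sum.cong) auto
      then show "(\<Sum>j\<in>{j \<in> {1..n}. restrict (\<psi> j) T = w}. g (x (restrict (\<psi> j) T))) = g (x w) * N w"
        unfolding fib[OF w] by (simp add: N_def)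
    qed
    finally have sum_eq: "(\<Sum>j=1..n. g (x (restrict (\<psi> j) T))) = (\<Sum>w\<in>?W. g (x w) * N w)" .
    have "\<bar>(1 / real n) * (\<Sum>j=1..n. g (\<psi> j)) - (\<Sum>w\<in>?W. g (x w) * (N w / n))\<bar>
        = \<bar>(1 / real n) * (\<Sum>j=1..n. g (\<psi> j) - g (x (restrict (\<psi> j) T)))\<bar>"
      unfolding sum_subtractf sum_eq right_diff_distrib sum_distrib_left by simp
    also have "\<dots> = (1 / real n) * \<bar>\<Sum>j=1..n. g (\<psi> j) - g (x (restrict (\<psi> j) T))\<bar>"
      by (simp add: abs_mult)
    also have "\<dots> \<le> (1 / real n) * (\<Sum>j=1..n. \<delta>/4)"
    proof (intro mult_left_mono)
      have "\<bar>g (\<psi> j) - g (x (restrict (\<psi> j) T))\<bar> \<le> \<delta>/4" if j: "j \<in> {1..n}" for j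
        using x[OF rW[OF j]] \<psi>[OF j] by (intro less_imp_le win) auto
      then have "(\<Sum>j=1..n. \<bar>g (\<psi> j) - g (x (restrict (\<psi> j) T))\<bar>) \<le> (\<Sum>j=1..n. \<delta>/4)"
        by (rule sum_mono)
      then show "\<bar>\<Sum>j=1..n. g (\<psi> j) - g (x (restrict (\<psi> j) T))\<bar> \<le> (\<Sum>j=1..n. \<delta>/4)"
        by (rule order_trans[OF sum_abs])
    qed simp
    also have "\<dots> = \<delta>/4" using n by simp
    finally have 1: "\<bar>(1 / real n) * (\<Sum>j=1..n. g (\<psi> j)) - (\<Sum>w\<in>?W. g (x w) * (N w / n))\<bar> \<le> \<delta>/4" .
    have "\<bar>(\<Sum>w\<in>?W. g (x w) * (N w / n)) - (\<Sum>w\<in>?W. g (x w) * (\<Prod>t\<in>T. measure p {w t}))\<bar>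
        = \<bar>\<Sum>w\<in>?W. g (x w) * (N w / n - (\<Prod>t\<in>T. measure p {w t}))\<bar>"
      unfolding sum_subtractf[symmetric] right_diff_distrib[symmetric] ..
    also have "\<dots> \<le> (\<Sum>w\<in>?W. \<bar>g (x w) * (N w / n - (\<Prod>t\<in>T. measure p {w t}))\<bar>)" by (rule sum_abs)
    also have "\<dots> \<le> (\<Sum>w\<in>?W. \<bar>g (x w)\<bar> * \<xi>)"
    proof (rule sum_mono)
      fix w assume "w \<in> ?W"
      from less_imp_le[OF freq[OF this]] have "\<bar>N w / n - (\<Prod>t\<in>T. measure p {w t})\<bar> \<le> \<xi>"
        by (simp only: N_def)
      then show "\<bar>g (x w) * (N w / n - (\<Prod>t\<in>T. measure p {w t}))\<bar> \<le> \<bar>g (x w)\<bar> * \<xi>"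
        unfolding abs_mult by (rule mult_left_mono) simp
    qed
    also have "\<dots> = (B - 1) * \<xi>" by (simp add: B_def sum_distrib_right)
    also have "\<dots> \<le> B * \<xi>" using \<xi>(1) by (intro mult_right_mono) auto
    also note \<xi>(2)
    finally have 2: "\<bar>(\<Sum>w\<in>?W. g (x w) * (N w / n)) - (\<Sum>w\<in>?W. g (x w) * (\<Prod>t\<in>T. measure p {w t}))\<bar> \<le> \<delta>/4" .
    have 3: "\<bar>(\<Sum>w\<in>?W. g (x w) * (\<Prod>t\<in>T. measure p {w t})) - integral\<^sup>L (Pi\<^sub>M (carrier G) (\<lambda>_. p)) g\<bar> \<le> \<delta>/4"
      by (rule integral_cylinder_approximation[OF \<open>k \<ge> 1\<close> g T x win])
    show "\<bar>(1 / real n) * (\<Sum>j=1..n. g (\<psi> j)) - integral\<^sup>L (Pi\<^sub>M (carrier G) (\<lambda>_. p)) g\<bar> < \<delta>"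
      using 1 2 3 \<open>\<delta> > 0\<close> by linarith
  qed
qed

end

lemma gibbs_normaliser_pos:
  fixes a :: "nat \<Rightarrow> real"
  assumes "k \<ge> 1" shows "(\<Sum>j<k. exp (a j)) > 0"
  using assms by (intro sum_pos) (auto simp: lessThan_empty_iff)

lemma
  assumes "k \<ge> 1"
  shows prob_space_gibbs: "prob_space (gibbs_measure k a)"
    and sets_gibbs: "sets (gibbs_measure k a) = Pow {..<k}"
    and measure_gibbs: "i < k \<Longrightarrow> measure (gibbs_measure k a) {i} = exp (a i) / (\<Sum>j<k. exp (a j))"
    and integral_gibbs: "integral\<^sup>L (gibbs_measure k a) a = (\<Sum>i<k. exp (a i) / (\<Sum>j<k. exp (a j)) * a i)"
proof -
  let ?Z = "\<Sum>j<k. exp (a j)"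
  have Z: "?Z > 0" by (rule gibbs_normaliser_pos[OF assms])
  have "emeasure (gibbs_measure k a) {..<k} = (\<Sum>i<k. ennreal (exp (a i) / ?Z))"
    unfolding gibbs_measure_def by (rule emeasure_point_measure_finite) auto
  also have "\<dots> = ennreal (\<Sum>i<k. exp (a i) / ?Z)" using Z by (intro sum_ennreal) auto
  also have "\<dots> = 1" using Z by (simp add: sum_divide_distrib[symmetric])
  finally show "prob_space (gibbs_measure k a)"
    by (intro prob_spaceI) (simp add: gibbs_measure_def space_point_measure)
  show "sets (gibbs_measure k a) = Pow {..<k}"
    by (simp add: gibbs_measure_def sets_point_measure)
  show "measure (gibbs_measure k a) {i} = exp (a i) / ?Z" if "i < k"
    unfolding gibbs_measure_def using Z that by (subst measure_point_measure_finite_if) auto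
  show "integral\<^sup>L (gibbs_measure k a) a = (\<Sum>i<k. exp (a i) / ?Z * a i)"
    unfolding gibbs_measure_def using Z by (subst lebesgue_integral_point_measure_finite) auto
qed

lemma integral_PiM_gibbs_coordinate:
  assumes "k \<ge> 1" "t \<in> carrier G"
  shows "integral\<^sup>L (Pi\<^sub>M (carrier G) (\<lambda>_. gibbs_measure k a)) (\<lambda>x. a (x t))
    = (\<Sum>i<k. exp (a i) / (\<Sum>j<k. exp (a j)) * a i)"
proof -
  let ?p = "gibbs_measure k a" and ?M = "Pi\<^sub>M (carrier G) (\<lambda>_. gibbs_measure k a)"
  have "distr ?M ?p (\<lambda>x. x t) = ?p"
    using prob_space_gibbs[OF assms(1)] assms(2) by (intro distr_PiM_component)
  then have "integral\<^sup>L ?p a = integral\<^sup>L (distr ?M ?p (\<lambda>x. x t)) a" by simp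
  also have "\<dots> = integral\<^sup>L ?M (\<lambda>x. a (x t))"
    using assms by (intro integral_distr measurable_component_singleton) (auto simp: gibbs_measure_def)
  finally show ?thesis using integral_gibbs[OF assms(1), of a] by simp
qed

section \<open>Random colourings are good models\<close>

lemma complement_fraction_tendsto_0:
  assumes lim: "(\<lambda>i. real (card {j \<in> {1..d i}. P i j}) / real (d i)) \<longlonglongrightarrow> 1"
    and d: "filterlim d at_top sequentially"
  shows "(\<lambda>i. real (card {j \<in> {1..d i}. \<not> P i j}) / real (d i)) \<longlonglongrightarrow> 0"
proof -
  have "(\<lambda>i. 1 - real (card {j \<in> {1..d i}. P i j}) / real (d i)) \<longlonglongrightarrow> 1 - 1"
    by (intro tendsto_diff lim tendsto_const)
  moreover have "\<forall>\<^sub>F i in sequentially. 1 - real (card {j \<in> {1..d i}. P i j}) / real (d i)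
      = real (card {j \<in> {1..d i}. \<not> P i j}) / real (d i)"
  proof -
    have "\<forall>\<^sub>F i in sequentially. d i > 0"
      using d eventually_gt_at_top[of 0] by (auto simp: filterlim_iff)
    then show ?thesis
    proof eventually_elim
      case (elim i)
      have un: "{j \<in> {1..d i}. P i j} \<union> {j \<in> {1..d i}. \<not> P i j} = {1..d i}" by auto
      have "card {j \<in> {1..d i}. P i j} + card {j \<in> {1..d i}. \<not> P i j}
          = card ({j \<in> {1..d i}. P i j} \<union> {j \<in> {1..d i}. \<not> P i j})"
        by (rule card_Un_disjoint[symmetric]) auto
      also have "\<dots> = d i" unfolding un by simp
      finally have "card {j \<in> {1..d i}. P i j} + card {j \<in> {1..d i}. \<not> P i j} = d i" .
      then have "real (card {j \<in> {1..d i}. \<not> P i j}) = real (d i) - real (card {j \<in> {1..d i}. P i j})"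
        by simp
      then show ?case using elim by (simp add: diff_divide_distrib)
    qed
  qed
  ultimately show ?thesis by (simp add: tendsto_cong)
qed

lemma sum_UN_le:
  fixes f :: "'b \<Rightarrow> real"
  assumes "finite A" "\<And>x. x \<in> A \<Longrightarrow> finite (B x)" "\<And>y. f y \<ge> 0"
  shows "sum f (\<Union>x\<in>A. B x) \<le> (\<Sum>x\<in>A. sum f (B x))"
  using assms(1,2)
proof (induction A rule: finite_induct)
  case (insert x A)
  have "sum f (B x \<union> (\<Union>x\<in>A. B x)) \<le> sum f (B x) + sum f (\<Union>x\<in>A. B x)"
    using insert by (subst sum_Un) (auto intro: sum_nonneg assms(3))
  also have "\<dots> \<le> sum f (B x) + (\<Sum>x\<in>A. sum f (B x))" using insert by simp
  finally show ?case using insert by simp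
qed simp

lemma finite_union_fraction_tendsto_0:
  assumes "finite I"
    and lim: "\<And>x. x \<in> I \<Longrightarrow> (\<lambda>i. real (card {j \<in> {1..d i}. P x i j}) / real (d i)) \<longlonglongrightarrow> 0"
  shows "(\<lambda>i. real (card {j \<in> {1..d i}. \<exists>x\<in>I. P x i j}) / real (d i)) \<longlonglongrightarrow> 0"
proof (rule tendsto_sandwich[OF _ _ tendsto_const])
  have "(\<lambda>i. \<Sum>x\<in>I. real (card {j \<in> {1..d i}. P x i j}) / real (d i)) \<longlonglongrightarrow> (\<Sum>x\<in>I. 0)"
    by (intro tendsto_sum lim)
  then show "(\<lambda>i. \<Sum>x\<in>I. real (card {j \<in> {1..d i}. P x i j}) / real (d i)) \<longlonglongrightarrow> 0" by simp
  show "\<forall>\<^sub>F i in sequentially. real (card {j \<in> {1..d i}. \<exists>x\<in>I. P x i j}) / real (d i)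
      \<le> (\<Sum>x\<in>I. real (card {j \<in> {1..d i}. P x i j}) / real (d i))"
  proof (intro always_eventually allI)
    fix i
    have "{j \<in> {1..d i}. \<exists>x\<in>I. P x i j} = (\<Union>x\<in>I. {j \<in> {1..d i}. P x i j})" by auto
    then have "card {j \<in> {1..d i}. \<exists>x\<in>I. P x i j} \<le> (\<Sum>x\<in>I. card {j \<in> {1..d i}. P x i j})"
      using card_UN_le[OF assms(1), of "\<lambda>x. {j \<in> {1..d i}. P x i j}"] by simp
    then have "real (card {j \<in> {1..d i}. \<exists>x\<in>I. P x i j}) \<le> (\<Sum>x\<in>I. real (card {j \<in> {1..d i}. P x i j}))"
      unfolding of_nat_sum[symmetric] by (rule of_nat_mono)
    then show "real (card {j \<in> {1..d i}. \<exists>x\<in>I. P x i j}) / real (d i)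
      \<le> (\<Sum>x\<in>I. real (card {j \<in> {1..d i}. P x i j}) / real (d i))"
      unfolding sum_divide_distrib[symmetric] by (rule divide_right_mono) simp
  qed
qed (intro always_eventually allI divide_nonneg_nonneg; simp)

text \<open>The map that is equivariant as far as \<open>\<sigma>\<close> is an action.  Up to the permutation \<open>\<sigma> (inv \<one>)\<close> this
inverts the passage from an equivariant map to its colouring \<open>j \<mapsto> \<phi> j \<one>\<close>.\<close>

definition colouring_model ::
  "('g, 'm) monoid_scheme \<Rightarrow> nat \<Rightarrow> ('g \<Rightarrow> nat \<Rightarrow> nat) \<Rightarrow> (nat \<Rightarrow> nat) \<Rightarrow> nat \<Rightarrow> 'g \<Rightarrow> nat" where
  "colouring_model G n \<sigma> \<omega> = (\<lambda>j\<in>{1..n}. \<lambda>t\<in>carrier G. \<omega> (\<sigma> (inv\<^bsub>G\<^esub> t) j))"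

context
  fixes G :: "('g, 'm) monoid_scheme" (structure) and k :: nat
    and d :: "nat \<Rightarrow> nat" and \<sigma> :: "nat \<Rightarrow> 'g \<Rightarrow> nat \<Rightarrow> nat"
  assumes G: "group G" and sofic: "sofic_approximation G d \<sigma>"
begin

interpretation group G by (rule G)

lemma sofic_permutes: "s \<in> carrier G \<Longrightarrow> \<sigma> i s permutes {1..d i}"
  using sofic by (simp add: sofic_approximation_def)

lemma sofic_dimension: "filterlim d at_top sequentially"
  using sofic by (simp add: sofic_approximation_def)

lemma sofic_dimension_pos: "\<forall>\<^sub>F i in sequentially. d i > 0"
  using sofic_dimension eventually_gt_at_top[of 0] by (auto simp: filterlim_iff)

lemma sofic_multiplicative_defect:
  assumes "s \<in> carrier G" "t \<in> carrier G"
  shows "(\<lambda>i. real (card {j \<in> {1..d i}. \<sigma> i s (\<sigma> i t j) \<noteq> \<sigma> i (s \<otimes> t) j}) / real (d i)) \<longlonglongrightarrow> 0"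
  using assms sofic by (intro complement_fraction_tendsto_0 sofic_dimension) (simp add: sofic_approximation_def)

lemma sofic_non_injective_fraction:
  assumes T: "finite T" "T \<subseteq> carrier G"
  shows "(\<lambda>i. real (card {j \<in> {1..d i}. \<not> inj_on (\<lambda>t. \<sigma> i (inv t) j) T}) / real (d i)) \<longlonglongrightarrow> 0"
proof -
  let ?I = "{tu \<in> T \<times> T. fst tu \<noteq> snd tu}"
  have "(\<lambda>i. real (card {j \<in> {1..d i}. \<exists>tu\<in>?I. \<sigma> i (inv fst tu) j = \<sigma> i (inv snd tu) j}) / real (d i)) \<longlonglongrightarrow> 0"
  proof (rule finite_union_fraction_tendsto_0)
    show "finite ?I" using T(1) by simp
    fix tu assume tu: "tu \<in> ?I"
    then have "fst tu \<in> carrier G" "snd tu \<in> carrier G" "fst tu \<noteq> snd tu" using T(2) by auto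
    then have "inv fst tu \<in> carrier G" "inv snd tu \<in> carrier G" "inv fst tu \<noteq> inv snd tu"
      by (auto dest: arg_cong[where f="m_inv G"])
    then have "(\<lambda>i. real (card {j \<in> {1..d i}. \<sigma> i (inv fst tu) j \<noteq> \<sigma> i (inv snd tu) j}) / real (d i)) \<longlonglongrightarrow> 1"
      using sofic by (simp add: sofic_approximation_def)
    from complement_fraction_tendsto_0[OF this sofic_dimension]
    show "(\<lambda>i. real (card {j \<in> {1..d i}. \<sigma> i (inv fst tu) j = \<sigma> i (inv snd tu) j}) / real (d i)) \<longlonglongrightarrow> 0"
      by simp
  qed
  moreover have "(\<exists>tu\<in>?I. \<sigma> i (inv fst tu) j = \<sigma> i (inv snd tu) j) \<longleftrightarrow> \<not> inj_on (\<lambda>t. \<sigma> i (inv t) j) T" for i j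
    by (auto simp: inj_on_def)
  ultimately show ?thesis by simp
qed

lemma colouring_model_in_full_shift:
  assumes "\<omega> \<in> {1..d i} \<rightarrow>\<^sub>E {..<k}" "j \<in> {1..d i}"
  shows "colouring_model G (d i) (\<sigma> i) \<omega> j \<in> topspace (full_shift G k)"
proof -
  have "\<omega> (\<sigma> i (inv t) j) < k" if "t \<in> carrier G" for t
  proof -
    have "\<sigma> i (inv t) j \<in> {1..d i}"
      using permutes_in_image[OF sofic_permutes, of "inv t" i j] that assms(2) by simp
    then show ?thesis using PiE_mem[OF assms(1)] by blast
  qed
  then show ?thesis using assms(2) by (simp add: colouring_model_def topspace_full_shift)
qed

text \<open>At the coordinate \<open>t\<close> the two sides read \<open>\<omega>\<close> at \<open>\<sigma> (inv t \<otimes> s) j\<close> and at \<open>\<sigma> (inv t) (\<sigma> s j)\<close>, so the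
model is equivariant wherever \<open>\<sigma>\<close> is multiplicative.\<close>

lemma colouring_model_shift:
  assumes j: "j \<in> {1..d i}" and s: "s \<in> carrier G" and t: "t \<in> carrier G"
    and mult: "\<sigma> i (inv t) (\<sigma> i s j) = \<sigma> i (inv t \<otimes> s) j"
  shows "left_shift G s (colouring_model G (d i) (\<sigma> i) \<omega> j) t = colouring_model G (d i) (\<sigma> i) \<omega> (\<sigma> i s j) t"
proof -
  have "\<sigma> i s j \<in> {1..d i}" using permutes_in_image[OF sofic_permutes[OF s], of i j] j by simp
  moreover have "inv (inv s \<otimes> t) = inv t \<otimes> s" using s t by (simp add: inv_mult_group)
  ultimately show ?thesis
    using j s t mult by (simp add: left_shift_def colouring_model_def)
qed

text \<open>Only the sites where \<open>\<sigma>\<close> fails to be multiplicative on a finite set contribute more than \<open>(\<delta>/2)\<^sup>2\<close> to the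
sum of squares.  Their proportion tends to 0, and there the compactness of the full shift bounds \<open>\<rho>\<close>.
The set of these sites does not involve \<open>\<omega>\<close>, so the statement holds for all colourings at once.\<close>

lemma eventually_colouring_model_in_Map_sofic:
  assumes \<rho>: "compatible_metric (full_shift G k) \<rho>"
    and F: "finite F" "F \<noteq> {}" "F \<subseteq> carrier G" and "\<delta> > 0"
  shows "\<forall>\<^sub>F i in sequentially. \<forall>\<omega>\<in>{1..d i} \<rightarrow>\<^sub>E {..<k}.
    colouring_model G (d i) (\<sigma> i) \<omega> \<in> Map_sofic (full_shift G k) (left_shift G) \<rho> F \<delta> (d i) (\<sigma> i)"
proof -
  let ?X = "topspace (full_shift G k)"
  interpret M: Metric_space ?X \<rho> using \<rho> by (simp add: compatible_metric_def)
  have "\<delta>/2 > 0" using \<open>\<delta> > 0\<close> by simp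
  obtain T where T: "finite T" "T \<subseteq> carrier G"
    and win: "\<And>x y. x \<in> ?X \<Longrightarrow> y \<in> ?X \<Longrightarrow> \<forall>t\<in>T. x t = y t \<Longrightarrow> \<rho> x y < \<delta>/2"
    using window_compatible_metric[OF \<rho> \<open>\<delta>/2 > 0\<close>] by blast
  obtain D where D: "D > 0" "\<And>x y. x \<in> ?X \<Longrightarrow> y \<in> ?X \<Longrightarrow> \<rho> x y \<le> D"
    using compatible_metric_bounded[OF \<rho>] by blast
  define bad where "bad s i = {j \<in> {1..d i}. \<exists>t\<in>T. \<sigma> i (inv t) (\<sigma> i s j) \<noteq> \<sigma> i (inv t \<otimes> s) j}" for s i
  have lim: "(\<lambda>i. real (card (bad s i)) / real (d i)) \<longlonglongrightarrow> 0" if "s \<in> F" for s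
    unfolding bad_def using T F that
    by (intro finite_union_fraction_tendsto_0 sofic_multiplicative_defect) auto
  have "0 < \<delta>\<^sup>2 / (2 * D\<^sup>2)" using D(1) \<open>\<delta> > 0\<close> by simp
  then have "\<forall>\<^sub>F i in sequentially. real (card (bad s i)) / real (d i) < \<delta>\<^sup>2 / (2 * D\<^sup>2)" if "s \<in> F" for s
    using order_tendstoD(2)[OF lim[OF that]] by blast
  then have "\<forall>\<^sub>F i in sequentially. \<forall>s\<in>F. real (card (bad s i)) / real (d i) < \<delta>\<^sup>2 / (2 * D\<^sup>2)"
    using F(1) by (simp add: eventually_ball_finite_distrib)
  with sofic_dimension_pos show ?thesis
  proof eventually_elim
    case (elim i)
    show ?case
    proof
      fix \<omega> assume \<omega>: "\<omega> \<in> {1..d i} \<rightarrow>\<^sub>E {..<k}"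
      let ?\<phi> = "colouring_model G (d i) (\<sigma> i) \<omega>"
      have rho: "rho_2 (d i) \<rho> (left_shift G s \<circ> ?\<phi>) (?\<phi> \<circ> \<sigma> i s) < \<delta>" if s: "s \<in> F" for s
      proof -
        have sG: "s \<in> carrier G" using s F by blast
        let ?u = "\<lambda>j. \<rho> (left_shift G s (?\<phi> j)) (?\<phi> (\<sigma> i s j))"
        have \<sigma>j: "\<sigma> i s j \<in> {1..d i}" if "j \<in> {1..d i}" for j
          using permutes_in_image[OF sofic_permutes[OF sG], of i j] that by simp
        have inX: "left_shift G s (?\<phi> j) \<in> ?X" "?\<phi> (\<sigma> i s j) \<in> ?X" if "j \<in> {1..d i}" for j
        proof -
          show "?\<phi> (\<sigma> i s j) \<in> ?X" by (rule colouring_model_in_full_shift[OF \<omega> \<sigma>j[OF that]])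
          have "?\<phi> j \<in> ?X" by (rule colouring_model_in_full_shift[OF \<omega> that])
          then show "left_shift G s (?\<phi> j) \<in> ?X"
            using sG by (auto simp: topspace_full_shift left_shift_def PiE_iff)
        qed
        have "(\<Sum>j=1..d i. (?u j)\<^sup>2) \<le> (\<Sum>j=1..d i. (\<delta>/2)\<^sup>2 + (if j \<in> bad s i then D\<^sup>2 else 0))"
        proof (rule sum_mono)
          fix j assume j: "j \<in> {1..d i}"
          show "(?u j)\<^sup>2 \<le> (\<delta>/2)\<^sup>2 + (if j \<in> bad s i then D\<^sup>2 else 0)"
          proof (cases "j \<in> bad s i")
            case True
            have "(?u j)\<^sup>2 \<le> D\<^sup>2" by (intro power_mono D(2) inX j M.nonneg)
            then show ?thesis using True by (simp add: add_increasing)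
          next
            case False
            have "?u j < \<delta>/2"
            proof (rule win[OF inX[OF j]], rule)
              fix t assume t: "t \<in> T"
              show "left_shift G s (?\<phi> j) t = ?\<phi> (\<sigma> i s j) t"
                using False j t T(2) sG by (intro colouring_model_shift) (auto simp: bad_def)
            qed
            then have "(?u j)\<^sup>2 \<le> (\<delta>/2)\<^sup>2" by (intro power_mono less_imp_le M.nonneg)
            then show ?thesis using False by simp
          qed
        qed
        also have "\<dots> = real (d i) * (\<delta>/2)\<^sup>2 + real (card (bad s i)) * D\<^sup>2"
          by (simp add: sum.distrib sum.If_cases bad_def Int_def)
        also have "real (card (bad s i)) * D\<^sup>2 \<le> real (d i) * (\<delta>\<^sup>2 / 2)"
        proof -
          have "real (card (bad s i)) / real (d i) < \<delta>\<^sup>2 / (2 * D\<^sup>2)" using elim(2) s by blast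
          then show ?thesis using elim(1) D(1) by (simp add: field_simps)
        qed
        finally have "(\<Sum>j=1..d i. (?u j)\<^sup>2) \<le> real (d i) * (\<delta>\<^sup>2 * (3/4))"
          by (simp add: power_divide algebra_simps)
        then have "(1 / real (d i)) * (\<Sum>j=1..d i. (?u j)\<^sup>2) \<le> \<delta>\<^sup>2 * (3/4)"
          using elim(1) by (simp add: field_simps)
        also have "\<dots> < \<delta>\<^sup>2" using \<open>\<delta> > 0\<close> by simp
        finally have "sqrt ((1 / real (d i)) * (\<Sum>j=1..d i. (?u j)\<^sup>2)) < sqrt (\<delta>\<^sup>2)"
          by (rule real_sqrt_less_mono)
        then show ?thesis using \<open>\<delta> > 0\<close> by (simp add: rho_2_def)
      qed
      have "?\<phi> \<in> {1..d i} \<rightarrow>\<^sub>E ?X"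
        using colouring_model_in_full_shift[OF \<omega>] by (intro PiE_I) (auto simp: colouring_model_def)
      then show "?\<phi> \<in> Map_sofic (full_shift G k) (left_shift G) \<rho> F \<delta> (d i) (\<sigma> i)"
        unfolding Map_sofic_def using F rho by simp
    qed
  qed
qed

text \<open>The event is contained in finitely many deviation events for pattern frequencies, and the probability
of each tends to 0 because \<open>\<sigma>\<close> is asymptotically free and \<open>d\<close> tends to infinity.\<close>

lemma random_colouring_average_tendsto:
  assumes count: "countable (carrier G)" and prob: "prob_space p" and sets_p: "sets p = Pow {..<k}"
    and "k \<ge> 1" and g: "continuous_map (full_shift G k) euclideanreal g" and "\<delta> > 0"
  shows "(\<lambda>i. \<Sum>\<omega>\<in>{\<omega> \<in> {1..d i} \<rightarrow>\<^sub>E {..<k}.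
      \<not> \<bar>(1 / real (d i)) * (\<Sum>j=1..d i. g (colouring_model G (d i) (\<sigma> i) \<omega> j))
        - integral\<^sup>L (Pi\<^sub>M (carrier G) (\<lambda>_. p)) g\<bar> < \<delta>}. \<Prod>j=1..d i. measure p {\<omega> j}) \<longlonglongrightarrow> 0"
    (is "(\<lambda>i. sum (?W i) (?Bad i)) \<longlonglongrightarrow> 0")
proof -
  interpret p: prob_space p by (rule prob)
  obtain T \<xi> where T: "finite T" "T \<subseteq> carrier G" and \<xi>: "\<xi> > 0"
    and emp: "\<And>n \<psi>. n > 0 \<Longrightarrow> (\<And>j. j \<in> {1..n} \<Longrightarrow> \<psi> j \<in> topspace (full_shift G k)) \<Longrightarrow>
      (\<And>w. w \<in> T \<rightarrow>\<^sub>E {..<k} \<Longrightarrow> \<bar>real (card {j \<in> {1..n}. \<forall>t\<in>T. \<psi> j t = w t}) / real n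
          - (\<Prod>t\<in>T. measure p {w t})\<bar> < \<xi>) \<Longrightarrow>
      \<bar>(1 / real n) * (\<Sum>j=1..n. g (\<psi> j)) - integral\<^sup>L (Pi\<^sub>M (carrier G) (\<lambda>_. p)) g\<bar> < \<delta>"
    using empirical_average_close_to_integral[OF count prob sets_p \<open>k \<ge> 1\<close> g \<open>\<delta> > 0\<close>] by blast
  have q: "(\<Sum>c<k. measure p {c}) = 1"
  proof -
    have "(\<Sum>c<k. measure p {c}) = measure p {..<k}"
      using sets_p by (intro p.finite_measure_eq_sum_singleton[symmetric]) auto
    then show ?thesis using p.prob_space sets_eq_imp_space_eq[of p "count_space {..<k}"] sets_p by simp
  qed
  let ?P = "T \<rightarrow>\<^sub>E {..<k}"
  have finP: "finite ?P" using T(1) by (intro finite_PiE) auto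
  define dev where "dev i w = {\<omega> \<in> {1..d i} \<rightarrow>\<^sub>E {..<k}.
      \<xi> \<le> \<bar>real (card {j \<in> {1..d i}. \<forall>t\<in>T. \<omega> (\<sigma> i (inv t) j) = w t}) / real (card {1..d i})
        - (\<Prod>t\<in>T. measure p {w t})\<bar>}" for i w
  define bound where "bound i = (2 * (real (card {j \<in> {1..d i}. \<not> inj_on (\<lambda>t. \<sigma> i (inv t) j) T}) / real (d i))
      + real (card T ^ 2) / real (d i)) / \<xi>\<^sup>2" for i
  have W0: "?W i \<omega> \<ge> 0" for i \<omega> by (intro prod_nonneg) simp
  have fin_dev: "finite (dev i w)" for i w
    by (rule finite_subset[of _ "{1..d i} \<rightarrow>\<^sub>E {..<k}"]) (auto simp: dev_def intro: finite_PiE)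
  have dev_le: "sum (?W i) (dev i w) \<le> bound i" if "d i > 0" "w \<in> ?P" for i w
  proof -
    have "sum (?W i) (dev i w) \<le> (2 * (real (card {j \<in> {1..d i}. \<not> inj_on (\<lambda>t. \<sigma> i (inv t) j) T}) / real (card {1..d i}))
      + real (card T ^ 2) / real (card {1..d i})) / \<xi>\<^sup>2"
      unfolding dev_def
    proof (rule pattern_frequency_concentration[OF q _ T(1) _ _ _ \<xi>, where \<tau> = "\<lambda>j t. \<sigma> i (inv t) j"])
      show "inj_on (\<lambda>j. \<sigma> i (inv t) j) {1..d i}" if "t \<in> T" for t
        using permutes_inj_on[OF sofic_permutes] that T(2) by blast
      show "\<sigma> i (inv t) j \<in> {1..d i}" if "j \<in> {1..d i}" "t \<in> T" for j t
        using permutes_in_image[OF sofic_permutes, of "inv t" i j] that T(2) by auto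
    qed (use that in auto)
    then show ?thesis by (simp add: bound_def)
  qed
  have Bad_sub: "?Bad i \<subseteq> (\<Union>w\<in>?P. dev i w)" if "d i > 0" for i
  proof
    fix \<omega> assume \<omega>: "\<omega> \<in> ?Bad i"
    then have \<omega>P: "\<omega> \<in> {1..d i} \<rightarrow>\<^sub>E {..<k}" by simp
    show "\<omega> \<in> (\<Union>w\<in>?P. dev i w)"
    proof (rule ccontr)
      assume nd: "\<omega> \<notin> (\<Union>w\<in>?P. dev i w)"
      have "\<bar>(1 / real (d i)) * (\<Sum>j=1..d i. g (colouring_model G (d i) (\<sigma> i) \<omega> j))
        - integral\<^sup>L (Pi\<^sub>M (carrier G) (\<lambda>_. p)) g\<bar> < \<delta>"
      proof (rule emp[OF that])
        show "colouring_model G (d i) (\<sigma> i) \<omega> j \<in> topspace (full_shift G k)" if "j \<in> {1..d i}" for j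
          by (rule colouring_model_in_full_shift[OF \<omega>P that])
        fix w assume w: "w \<in> ?P"
        have "{j \<in> {1..d i}. \<forall>t\<in>T. colouring_model G (d i) (\<sigma> i) \<omega> j t = w t}
            = {j \<in> {1..d i}. \<forall>t\<in>T. \<omega> (\<sigma> i (inv t) j) = w t}"
          using T(2) by (auto simp: colouring_model_def subset_iff)
        moreover have "\<omega> \<notin> dev i w" using nd w by blast
        ultimately show "\<bar>real (card {j \<in> {1..d i}. \<forall>t\<in>T. colouring_model G (d i) (\<sigma> i) \<omega> j t = w t}) / real (d i)
            - (\<Prod>t\<in>T. measure p {w t})\<bar> < \<xi>"
          using \<omega>P by (simp add: dev_def not_le)
      qed
      then show False using \<omega> by simp
    qed
  qed
  have Bad_le: "sum (?W i) (?Bad i) \<le> real (card ?P) * bound i" if "d i > 0" for i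
  proof -
    have "sum (?W i) (?Bad i) \<le> sum (?W i) (\<Union>w\<in>?P. dev i w)"
      using finP fin_dev W0 by (intro sum_mono2 Bad_sub that finite_UN_I) auto
    also have "\<dots> \<le> (\<Sum>w\<in>?P. sum (?W i) (dev i w))"
      using finP fin_dev W0 by (intro sum_UN_le) auto
    also have "\<dots> \<le> (\<Sum>w\<in>?P. bound i)" by (intro sum_mono dev_le that)
    finally show ?thesis by simp
  qed
  have "(\<lambda>i. real (card T ^ 2) / real (d i)) \<longlonglongrightarrow> 0"
    by (intro real_tendsto_divide_at_top[OF tendsto_const]
        filterlim_compose[OF filterlim_real_sequentially sofic_dimension])
  then have "(\<lambda>i. real (card ?P) * bound i) \<longlonglongrightarrow> real (card ?P) * ((2 * 0 + 0) / \<xi>\<^sup>2)"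
    unfolding bound_def using \<xi> sofic_non_injective_fraction[OF T]
    by (intro tendsto_mult tendsto_divide tendsto_add tendsto_const) auto
  then have bound_lim: "(\<lambda>i. real (card ?P) * bound i) \<longlonglongrightarrow> 0" by simp
  show ?thesis
  proof (rule tendsto_sandwich[OF _ _ tendsto_const bound_lim])
    show "\<forall>\<^sub>F i in sequentially. 0 \<le> sum (?W i) (?Bad i)" using W0 by (intro always_eventually allI sum_nonneg)
    show "\<forall>\<^sub>F i in sequentially. sum (?W i) (?Bad i) \<le> real (card ?P) * bound i"
      using sofic_dimension_pos by eventually_elim (rule Bad_le)
  qed
qed

text \<open>The identity coordinates of the model are the values of \<open>\<omega>\<close>, rearranged by a permutation, so distinct
colourings give models that differ in an identity coordinate somewhere.\<close>

lemma rho_inf_colouring_models_ge: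
  assumes r: "\<And>x y. x \<in> topspace (full_shift G k) \<Longrightarrow> y \<in> topspace (full_shift G k) \<Longrightarrow>
      \<rho> x y < r \<Longrightarrow> x \<one> = y \<one>"
    and "d i > 0" and \<omega>: "\<omega> \<in> {1..d i} \<rightarrow>\<^sub>E {..<k}" and \<omega>': "\<omega>' \<in> {1..d i} \<rightarrow>\<^sub>E {..<k}" and "\<omega> \<noteq> \<omega>'"
  shows "r \<le> rho_inf (d i) \<rho> (colouring_model G (d i) (\<sigma> i) \<omega>) (colouring_model G (d i) (\<sigma> i) \<omega>')"
proof (rule ccontr)
  let ?\<phi> = "colouring_model G (d i) (\<sigma> i) \<omega>" and ?\<psi> = "colouring_model G (d i) (\<sigma> i) \<omega>'"
  assume "\<not> ?thesis"
  then have "(MAX j\<in>{1..d i}. \<rho> (?\<phi> j) (?\<psi> j)) < r" by (simp add: rho_inf_def)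
  then have less: "\<rho> (?\<phi> j) (?\<psi> j) < r" if "j \<in> {1..d i}" for j
    by (rule le_less_trans[OF Max_ge[OF finite_imageI[OF finite_atLeastAtMost] imageI[OF that]]])
  have "\<omega> l = \<omega>' l" if l: "l \<in> {1..d i}" for l
  proof -
    have "\<sigma> i (inv \<one>) ` {1..d i} = {1..d i}" by (intro permutes_image sofic_permutes inv_closed one_closed)
    with l have "l \<in> \<sigma> i (inv \<one>) ` {1..d i}" by (simp only:)
    then obtain j where j: "j \<in> {1..d i}" "\<sigma> i (inv \<one>) j = l" by (elim imageE) simp
    have "?\<phi> j \<one> = ?\<psi> j \<one>"
      by (rule r[OF colouring_model_in_full_shift[OF \<omega> j(1)]
            colouring_model_in_full_shift[OF \<omega>' j(1)] less[OF j(1)]])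
    then show ?thesis using j by (simp add: colouring_model_def)
  qed
  then have "\<omega> = \<omega>'" by (rule PiE_ext[OF \<omega> \<omega>'])
  then show False using \<open>\<omega> \<noteq> \<omega>'\<close> by contradiction
qed

text \<open>Colour the sites independently with the Gibbs weights.  With probability at least one half the model
is good for \<open>L\<close> and for the potential \<open>x \<mapsto> a (x \<one>)\<close>.  The logarithm of the weight of a colouring is the
sum of the potential over its model, minus \<open>n ln Z\<close>; so every good colouring has weight at most
\<open>exp (n (c + \<eta>/2 - ln Z))\<close>, and there must be many of them.  The potential thus takes over the role of
the asymptotic equipartition property.\<close>

lemma eventually_max_separated_ge:
  fixes a :: "nat \<Rightarrow> real"
  defines "Z \<equiv> \<Sum>j<k. exp (a j)"
  defines "c \<equiv> \<Sum>i<k. exp (a i) / Z * a i"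
  assumes count: "countable (carrier G)" and "k \<ge> 1"
    and \<rho>: "compatible_metric (full_shift G k) \<rho>"
    and r: "r > 0" "\<And>x y. x \<in> topspace (full_shift G k) \<Longrightarrow> y \<in> topspace (full_shift G k) \<Longrightarrow>
      \<rho> x y < r \<Longrightarrow> x \<one> = y \<one>"
    and F: "finite F" "F \<noteq> {}" "F \<subseteq> carrier G"
    and L: "finite L" "\<And>g. g \<in> L \<Longrightarrow> continuous_map (full_shift G k) euclideanreal g"
    and "\<delta> > 0" "\<eta> > 0"
  shows "\<forall>\<^sub>F i in sequentially. ennreal (exp (real (d i) * (ln Z - c - \<eta>)))
    \<le> max_separated r (Map_sofic_measure (full_shift G k) (left_shift G)
          (Pi\<^sub>M (carrier G) (\<lambda>_. gibbs_measure k a)) \<rho> F L \<delta> (d i) (\<sigma> i)) (rho_inf (d i) \<rho>)"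
proof -
  let ?p = "gibbs_measure k a"
  let ?M = "Pi\<^sub>M (carrier G) (\<lambda>_. ?p)"
  let ?f = "\<lambda>x. a (x \<one>) :: real"
  interpret M: Metric_space "topspace (full_shift G k)" \<rho> using \<rho> by (simp add: compatible_metric_def)
  note p = prob_space_gibbs[OF \<open>k \<ge> 1\<close>, of a] sets_gibbs[OF \<open>k \<ge> 1\<close>, of a]
  have Z: "Z > 0" unfolding Z_def by (rule gibbs_normaliser_pos[OF \<open>k \<ge> 1\<close>])
  have int_f: "integral\<^sup>L ?M ?f = c"
    unfolding c_def Z_def by (rule integral_PiM_gibbs_coordinate[OF \<open>k \<ge> 1\<close> one_closed])
  define L' where "L' = insert ?f L"
  define \<delta>' where "\<delta>' = min \<delta> (\<eta>/2)"
  have \<delta>': "\<delta>' > 0" "\<delta>' \<le> \<delta>" "\<delta>' \<le> \<eta>/2" using \<open>\<delta> > 0\<close> \<open>\<eta> > 0\<close> by (auto simp: \<delta>'_def)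
  have L': "continuous_map (full_shift G k) euclideanreal g" if "g \<in> L'" for g
    using L(2) that continuous_map_coordinate_function[of "\<one>" G k a] by (auto simp: L'_def)
  have finL': "finite L'" using L(1) by (simp add: L'_def)
  let ?\<Omega> = "\<lambda>i. {1..d i} \<rightarrow>\<^sub>E {..<k}"
  let ?\<phi> = "\<lambda>i. colouring_model G (d i) (\<sigma> i)"
  define w where "w i \<omega> = (\<Prod>j=1..d i. measure ?p {\<omega> j})" for i \<omega>
  define bad where "bad i g = {\<omega> \<in> ?\<Omega> i. \<not> \<bar>(1 / real (d i)) * (\<Sum>j=1..d i. g (?\<phi> i \<omega> j)) - integral\<^sup>L ?M g\<bar> < \<delta>'}" for i g
  have w0: "w i \<omega> \<ge> 0" for i \<omega> unfolding w_def by (intro prod_nonneg) simp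
  have fin: "finite (?\<Omega> i)" for i by (intro finite_PiE) auto
  have fin_bad: "finite (bad i g)" for i g
    by (rule finite_subset[OF _ fin[of i]]) (auto simp: bad_def)
  have "(\<lambda>i. \<Sum>g\<in>L'. sum (w i) (bad i g)) \<longlonglongrightarrow> (\<Sum>g\<in>L'. 0)"
    unfolding w_def bad_def
    by (intro tendsto_sum random_colouring_average_tendsto count p \<open>k \<ge> 1\<close> L' \<delta>')
  then have "\<forall>\<^sub>F i in sequentially. (\<Sum>g\<in>L'. sum (w i) (bad i g)) < 1/2"
    by (intro order_tendstoD(2)) auto
  moreover have "\<forall>\<^sub>F i in sequentially. 2 / \<eta> \<le> real (d i)"
    using filterlim_compose[OF filterlim_real_sequentially sofic_dimension]
    by (simp add: filterlim_at_top)
  ultimately show ?thesis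
    using sofic_dimension_pos eventually_colouring_model_in_Map_sofic[OF \<rho> F \<open>\<delta> > 0\<close>]
  proof eventually_elim
    case (elim i)
    let ?n = "real (d i)"
    define good where "good = ?\<Omega> i - (\<Union>g\<in>L'. bad i g)"
    have fin_good: "finite good" using fin by (simp add: good_def)
    have "1 = sum (w i) (?\<Omega> i)"
    proof -
      have "(\<Sum>c<k. measure ?p {c}) = (\<Sum>c<k. exp (a c) / Z)"
        using measure_gibbs[OF \<open>k \<ge> 1\<close>] by (intro sum.cong) (auto simp: Z_def)
      also have "\<dots> = 1" using Z by (simp add: sum_divide_distrib[symmetric] Z_def)
      finally show ?thesis unfolding w_def by (intro sum_weights_eq_1[symmetric]) auto
    qed
    also have "\<dots> \<le> sum (w i) good + sum (w i) (\<Union>g\<in>L'. bad i g)"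
    proof -
      have "sum (w i) (?\<Omega> i) \<le> sum (w i) (good \<union> (\<Union>g\<in>L'. bad i g))"
        using fin_good finL' fin_bad w0 by (intro sum_mono2) (auto simp: good_def)
      also have "\<dots> = sum (w i) good + sum (w i) (\<Union>g\<in>L'. bad i g)"
        using fin_good finL' fin_bad by (intro sum.union_disjoint) (auto simp: good_def)
      finally show ?thesis .
    qed
    also have "sum (w i) (\<Union>g\<in>L'. bad i g) \<le> (\<Sum>g\<in>L'. sum (w i) (bad i g))"
      using finL' fin_bad w0 by (intro sum_UN_le) auto
    also have "\<dots> < 1/2" by (rule elim(1))
    finally have half: "1/2 \<le> sum (w i) good" by simp
    have w_le: "w i \<omega> \<le> exp (?n * (c + \<eta>/2 - ln Z))" if \<omega>: "\<omega> \<in> good" for \<omega>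
    proof -
      have \<omega>P: "\<omega> \<in> ?\<Omega> i" using \<omega> by (simp add: good_def)
      have "\<omega> \<notin> bad i ?f" using \<omega> by (auto simp: good_def L'_def)
      then have "\<bar>(1 / ?n) * (\<Sum>j=1..d i. a (?\<phi> i \<omega> j \<one>)) - c\<bar> < \<delta>'"
        using \<omega>P unfolding bad_def int_f by blast
      also have "(\<Sum>j=1..d i. a (?\<phi> i \<omega> j \<one>)) = (\<Sum>j=1..d i. a (\<omega> j))"
      proof -
        have "(\<Sum>j=1..d i. a (\<omega> j)) = (\<Sum>j=1..d i. a (\<omega> (\<sigma> i (inv \<one>) j)))"
          using sum.permute[OF sofic_permutes[of "inv \<one>" i], of "\<lambda>j. a (\<omega> j)"] by (simp add: o_def)
        then show ?thesis by (simp add: colouring_model_def)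
      qed
      finally have "(1 / ?n) * (\<Sum>j=1..d i. a (\<omega> j)) - c < \<delta>'" by (rule le_less_trans[OF abs_ge_self])
      then have "(1 / ?n) * (\<Sum>j=1..d i. a (\<omega> j)) < c + \<eta>/2" using \<delta>'(3) by linarith
      then have "(\<Sum>j=1..d i. a (\<omega> j)) \<le> ?n * (c + \<eta>/2)" using elim(3) by (simp add: field_simps)
      then have "exp ((\<Sum>j=1..d i. a (\<omega> j)) - ?n * ln Z) \<le> exp (?n * (c + \<eta>/2 - ln Z))"
        by (simp add: algebra_simps)
      moreover have "w i \<omega> = exp ((\<Sum>j=1..d i. a (\<omega> j)) - ?n * ln Z)"
      proof -
        have "w i \<omega> = (\<Prod>j=1..d i. exp (a (\<omega> j)) / Z)"
          unfolding w_def
        proof (rule prod.cong[OF refl])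
          fix j assume "j \<in> {1..d i}"
          then have "\<omega> j < k" using PiE_mem[OF \<omega>P] by blast
          then show "measure ?p {\<omega> j} = exp (a (\<omega> j)) / Z"
            using measure_gibbs[OF \<open>k \<ge> 1\<close>, of "\<omega> j" a] by (simp add: Z_def)
        qed
        also have "\<dots> = exp (\<Sum>j=1..d i. a (\<omega> j)) / Z ^ d i" by (simp add: prod_dividef exp_sum)
        also have "Z ^ d i = exp (?n * ln Z)" using Z by (simp add: exp_of_nat_mult)
        finally show ?thesis by (simp add: exp_diff)
      qed
      ultimately show ?thesis by simp
    qed
    have "1/2 \<le> real (card good) * exp (?n * (c + \<eta>/2 - ln Z))"
      using half sum_bounded_above[of good "w i", OF w_le] by simp
    \<comment> \<open>The half of the probability that may be lost is paid for by the second \<open>\<eta>/2\<close>.\<close>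
    moreover have "exp (- ?n * (\<eta>/2)) \<le> 1/2"
    proof -
      have "1 \<le> ?n * (\<eta>/2)" using elim(2) \<open>\<eta> > 0\<close> by (simp add: field_simps)
      then have "2 \<le> exp (?n * (\<eta>/2))" using exp_ge_add_one_self[of "?n * (\<eta>/2)"] by linarith
      then show ?thesis by (simp add: exp_minus field_simps)
    qed
    ultimately have "exp (- ?n * (\<eta>/2)) \<le> real (card good) * exp (?n * (c + \<eta>/2 - ln Z))" by linarith
    then have "exp (- ?n * (\<eta>/2)) * exp (?n * (ln Z - c - \<eta>/2))
        \<le> real (card good) * exp (?n * (c + \<eta>/2 - ln Z)) * exp (?n * (ln Z - c - \<eta>/2))"
      by (rule mult_right_mono) simp
    moreover have "exp (- ?n * (\<eta>/2)) * exp (?n * (ln Z - c - \<eta>/2)) = exp (?n * (ln Z - c - \<eta>))"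
      unfolding exp_add[symmetric] by (rule arg_cong[where f=exp]) (simp add: algebra_simps)
    moreover have "exp (?n * (c + \<eta>/2 - ln Z)) * exp (?n * (ln Z - c - \<eta>/2)) = 1"
      unfolding exp_add[symmetric] by (simp add: algebra_simps)
    ultimately have card_good: "exp (?n * (ln Z - c - \<eta>)) \<le> real (card good)"
      by (simp add: mult.assoc)
    have sep: "r \<le> rho_inf (d i) \<rho> (?\<phi> i \<omega>) (?\<phi> i \<omega>')" if "\<omega> \<in> good" "\<omega>' \<in> good" "\<omega> \<noteq> \<omega>'" for \<omega> \<omega>'
      using that by (intro rho_inf_colouring_models_ge r elim(3)) (auto simp: good_def)
    have inj: "inj_on (?\<phi> i) good"
    proof (rule inj_onI, rule ccontr)
      fix \<omega> \<omega>' assume *: "\<omega> \<in> good" "\<omega>' \<in> good" "?\<phi> i \<omega> = ?\<phi> i \<omega>'" "\<omega> \<noteq> \<omega>'"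
      have "\<rho> (?\<phi> i \<omega> j) (?\<phi> i \<omega> j) = 0" if "j \<in> {1..d i}" for j
        using colouring_model_in_full_shift[of \<omega> i j] *(1) that by (simp add: good_def)
      then have "(MAX j\<in>{1..d i}. \<rho> (?\<phi> i \<omega> j) (?\<phi> i \<omega> j)) < r"
        using elim(3) r(1) by (subst Max_less_iff) auto
      then show False using sep[OF *(1,2,4)] *(3) by (simp add: rho_inf_def)
    qed
    have "?\<phi> i ` good \<subseteq> Map_sofic_measure (full_shift G k) (left_shift G) ?M \<rho> F L \<delta> (d i) (\<sigma> i)"
    proof (rule image_subsetI)
      fix \<omega> assume \<omega>: "\<omega> \<in> good"
      then have \<omega>P: "\<omega> \<in> ?\<Omega> i" by (simp add: good_def)
      have "\<bar>(1 / ?n) * (\<Sum>j=1..d i. g (?\<phi> i \<omega> j)) - integral\<^sup>L ?M g\<bar> < \<delta>" if "g \<in> L" for g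
      proof -
        have "\<omega> \<notin> bad i g" using \<omega> that by (auto simp: good_def L'_def)
        then have "\<bar>(1 / ?n) * (\<Sum>j=1..d i. g (?\<phi> i \<omega> j)) - integral\<^sup>L ?M g\<bar> < \<delta>'"
          using \<omega>P by (simp add: bad_def)
        then show ?thesis using \<delta>'(2) by linarith
      qed
      then show "?\<phi> i \<omega> \<in> Map_sofic_measure (full_shift G k) (left_shift G) ?M \<rho> F L \<delta> (d i) (\<sigma> i)"
        unfolding Map_sofic_measure_def using elim(4) \<omega>P by blast
    qed
    moreover have "separated (rho_inf (d i) \<rho>) r (?\<phi> i ` good)"
      using sep by (auto simp: separated_def)
    moreover have "card (?\<phi> i ` good) = card good" by (rule card_image[OF inj])
    ultimately have "of_nat (card good) \<le> max_separated r
        (Map_sofic_measure (full_shift G k) (left_shift G) ?M \<rho> F L \<delta> (d i) (\<sigma> i)) (rho_inf (d i) \<rho>)"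
      unfolding max_separated_def using fin_good by (intro SUP_upper2[of "?\<phi> i ` good"]) auto
    moreover have "ennreal (exp (?n * (ln Z - c - \<eta>))) \<le> of_nat (card good)"
      using card_good by (simp add: ennreal_of_nat_eq_real_of_nat ennreal_leI)
    ultimately show ?case by (rule order_trans[rotated])
  qed
qed

end

section \<open>Exponential growth rates\<close>

lemma ext_log_le:
  assumes "x \<le> ennreal (exp y)" shows "ext_log x \<le> ereal y"
proof (cases "x = 0")
  case False
  have fin: "x \<noteq> \<infinity>" using assms by (auto simp: top_unique)
  then obtain z where z: "x = ennreal z" "z \<ge> 0" by (cases x) auto
  then have "z > 0" "z \<le> exp y" using False assms by (auto simp: ennreal_le_iff less_le)
  then have "ln z \<le> y" using ln_le_cancel_iff[of z "exp y"] by simp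
  then show ?thesis using z False by (simp add: ext_log_def)
qed (simp add: ext_log_def)

lemma ext_log_ge:
  assumes "ennreal (exp y) \<le> x" shows "ereal y \<le> ext_log x"
proof (cases "x = \<infinity>")
  case False
  then obtain z where z: "x = ennreal z" "z \<ge> 0" by (cases x) auto
  then have le: "exp y \<le> z" using assms by (simp add: ennreal_le_iff)
  then have "z > 0" using less_le_trans[OF exp_gt_zero] by blast
  then have "y \<le> ln z" using le ln_le_cancel_iff[of "exp y" z] by simp
  then show ?thesis using z \<open>z > 0\<close> by (simp add: ext_log_def)
qed (simp add: ext_log_def)

lemma growth_rate_le:
  assumes "n > 0" "x \<le> ennreal (exp (real n * y))"
  shows "ereal (1 / real n) * ext_log x \<le> ereal y"
proof -
  have "ereal (1 / real n) * ext_log x \<le> ereal (1 / real n) * ereal (real n * y)"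
    by (intro ereal_mult_left_mono ext_log_le assms) simp
  then show ?thesis using assms(1) by simp
qed

lemma growth_rate_ge:
  assumes "n > 0" "ennreal (exp (real n * y)) \<le> x"
  shows "ereal y \<le> ereal (1 / real n) * ext_log x"
proof -
  have "ereal (1 / real n) * ereal (real n * y) \<le> ereal (1 / real n) * ext_log x"
    by (intro ereal_mult_left_mono ext_log_ge assms) simp
  then show ?thesis using assms(1) by simp
qed

lemma ereal_le_of_all_less:
  assumes "\<And>e. e > 0 \<Longrightarrow> ereal (y - e) \<le> x"
  shows "ereal y \<le> x"
proof (cases x)
  case (real z)
  have "y \<le> z + e" if "e > 0" for e using assms[OF that] real by simp
  then show ?thesis using real field_le_epsilon[of y z] by simp
next
  case MInf
  then show ?thesis using assms[of 1] by simp
qed simp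

lemma ereal_le_of_all_greater:
  assumes "\<And>e. e > 0 \<Longrightarrow> x \<le> ereal (y + e)"
  shows "x \<le> ereal y"
proof (cases x)
  case (real z)
  have "z \<le> y + e" if "e > 0" for e using assms[OF that] real by simp
  then show ?thesis using real field_le_epsilon[of z y] by simp
next
  case PInf
  then show ?thesis using assms[of 1] by simp
qed simp

section \<open>Comparing pressure and entropy\<close>

lemma pressure_sum_mono:
  assumes "\<delta>' \<le> \<delta>"
  shows "pressure_sum f X \<alpha> \<rho> \<epsilon> F \<delta>' n \<sigma> \<le> pressure_sum f X \<alpha> \<rho> \<epsilon> F \<delta> n \<sigma>"
proof -
  have "Map_sofic X \<alpha> \<rho> F \<delta>' n \<sigma> \<subseteq> Map_sofic X \<alpha> \<rho> F \<delta> n \<sigma>"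
    unfolding Map_sofic_def using assms by (auto intro: less_le_trans)
  then show ?thesis unfolding pressure_sum_def by (intro SUP_subset_mono) blast+
qed

text \<open>When \<open>f\<close> is one of the test functions, every map counted by the entropy has energy at least
\<open>n (\<integral>f - \<delta>)\<close>.\<close>

lemma max_separated_le_pressure_sum:
  assumes "f \<in> L" "n > 0"
  shows "ennreal (exp (real n * (integral\<^sup>L \<nu> f - \<delta>))) *
      max_separated \<epsilon> (Map_sofic_measure X \<alpha> \<nu> \<rho> F L \<delta> n \<sigma>) (rho_inf n \<rho>)
    \<le> pressure_sum f X \<alpha> \<rho> \<epsilon> F \<delta> n \<sigma>"
  unfolding max_separated_def SUP_mult_left_ennreal
proof (rule SUP_least, clarify)
  fix E assume E: "finite E" "E \<subseteq> Map_sofic_measure X \<alpha> \<nu> \<rho> F L \<delta> n \<sigma>" "separated (rho_inf n \<rho>) \<epsilon> E"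
  have sub: "E \<subseteq> Map_sofic X \<alpha> \<rho> F \<delta> n \<sigma>" using E(2) by (auto simp: Map_sofic_measure_def)
  have "ennreal (exp (real n * (integral\<^sup>L \<nu> f - \<delta>))) * of_nat (card E)
      = (\<Sum>\<phi>\<in>E. ennreal (exp (real n * (integral\<^sup>L \<nu> f - \<delta>))))"
    by (simp add: mult.commute)
  also have "\<dots> \<le> (\<Sum>\<phi>\<in>E. ennreal (exp (\<Sum>j=1..n. f (\<phi> j))))"
  proof (intro sum_mono ennreal_leI)
    fix \<phi> assume "\<phi> \<in> E"
    then have "\<phi> \<in> Map_sofic_measure X \<alpha> \<nu> \<rho> F L \<delta> n \<sigma>" using E(2) by blast
    then have "\<bar>(1 / real n) * (\<Sum>j=1..n. f (\<phi> j)) - integral\<^sup>L \<nu> f\<bar> < \<delta>"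
      using assms(1) unfolding Map_sofic_measure_def by blast
    then have "integral\<^sup>L \<nu> f - \<delta> \<le> (1 / real n) * (\<Sum>j=1..n. f (\<phi> j))"
      unfolding abs_less_iff by linarith
    then have "real n * (integral\<^sup>L \<nu> f - \<delta>) \<le> real n * ((1 / real n) * (\<Sum>j=1..n. f (\<phi> j)))"
      by (rule mult_left_mono) simp
    then show "exp (real n * (integral\<^sup>L \<nu> f - \<delta>)) \<le> exp (\<Sum>j=1..n. f (\<phi> j))"
      using assms(2) by simp
  qed
  also have "\<dots> \<le> pressure_sum f X \<alpha> \<rho> \<epsilon> F \<delta> n \<sigma>"
    unfolding pressure_sum_def using E sub by (intro SUP_upper) blast
  finally show "ennreal (exp (real n * (integral\<^sup>L \<nu> f - \<delta>))) * of_nat (card E)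
    \<le> pressure_sum f X \<alpha> \<rho> \<epsilon> F \<delta> n \<sigma>" .
qed

section \<open>Pressure, entropy and the variational formula\<close>

context
  fixes G :: "('g, 'm) monoid_scheme" (structure) and k :: nat and a :: "nat \<Rightarrow> real"
    and d :: "nat \<Rightarrow> nat" and \<sigma> :: "nat \<Rightarrow> 'g \<Rightarrow> nat \<Rightarrow> nat" and \<rho> :: "('g \<Rightarrow> nat) \<Rightarrow> ('g \<Rightarrow> nat) \<Rightarrow> real"
  assumes G: "group G" and count: "countable (carrier G)" and k: "k \<ge> 1"
    and sofic: "sofic_approximation G d \<sigma>" and \<rho>: "compatible_metric (full_shift G k) \<rho>"
begin

interpretation group G by (rule G)

text \<open>The lower bound comes from the maps counted by the entropy of the Gibbs measure, with the potential as
the only test function: they number \<open>exp (n (ln Z - c))\<close> and have energy \<open>n c\<close> each, up to small errors.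
The scale \<open>r\<close> at which they are separated depends on \<open>\<rho>\<close> alone.\<close>

lemma sofic_pressure_wrt_full_shift:
  "sofic_pressure_wrt G d \<sigma> (full_shift G k) (left_shift G) (\<lambda>x. a (x \<one>)) \<rho> = ereal (ln (\<Sum>j<k. exp (a j)))"
proof (rule antisym)
  let ?f = "\<lambda>x. a (x \<one>) :: real"
  let ?Z = "\<Sum>j<k. exp (a j)"
  let ?M = "Pi\<^sub>M (carrier G) (\<lambda>_. gibbs_measure k a)"
  let ?c = "\<Sum>i<k. exp (a i) / ?Z * a i"
  show "sofic_pressure_wrt G d \<sigma> (full_shift G k) (left_shift G) ?f \<rho> \<le> ereal (ln ?Z)"
    unfolding sofic_pressure_wrt_def
  proof (rule SUP_least, rule ereal_le_of_all_greater)
    fix \<epsilon> \<eta> :: real assume "\<epsilon> \<in> {0<..}" "\<eta> > 0"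
    then have "\<epsilon> > 0" by simp
    obtain F \<delta> where F: "finite F" "F \<noteq> {}" "F \<subseteq> carrier G" "\<delta> > 0"
      and le: "\<And>n \<sigma>. n > 0 \<Longrightarrow> (\<And>s. s \<in> carrier G \<Longrightarrow> \<sigma> s permutes {1..n}) \<Longrightarrow>
        pressure_sum ?f (full_shift G k) (left_shift G) \<rho> \<epsilon> F \<delta> n \<sigma> \<le> ennreal (exp (real n * (ln ?Z + \<eta>)))"
      using pressure_sum_upper_bound[OF G k \<rho> \<open>\<epsilon> > 0\<close> \<open>\<eta> > 0\<close>] by blast
    have "limsup (\<lambda>i. ereal (1 / real (d i)) *
        ext_log (pressure_sum ?f (full_shift G k) (left_shift G) \<rho> \<epsilon> F \<delta> (d i) (\<sigma> i))) \<le> ereal (ln ?Z + \<eta>)"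
    proof (rule Limsup_bounded)
      show "\<forall>\<^sub>F i in sequentially. ereal (1 / real (d i)) *
        ext_log (pressure_sum ?f (full_shift G k) (left_shift G) \<rho> \<epsilon> F \<delta> (d i) (\<sigma> i)) \<le> ereal (ln ?Z + \<eta>)"
        using sofic_dimension_pos[OF G sofic]
        by eventually_elim (intro growth_rate_le le sofic_permutes[OF G sofic])
    qed
    then show "(INF F\<in>{F. finite F \<and> F \<noteq> {} \<and> F \<subseteq> carrier G}. INF \<delta>\<in>{0<..}.
        limsup (\<lambda>i. ereal (1 / real (d i)) *
          ext_log (pressure_sum ?f (full_shift G k) (left_shift G) \<rho> \<epsilon> F \<delta> (d i) (\<sigma> i)))) \<le> ereal (ln ?Z + \<eta>)"
      using F by (intro INF_lower2[of F] INF_lower2[of \<delta>]) auto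
  qed
  obtain r where r: "r > 0" "\<And>x y. x \<in> topspace (full_shift G k) \<Longrightarrow>
      y \<in> topspace (full_shift G k) \<Longrightarrow> \<rho> x y < r \<Longrightarrow> x \<one> = y \<one>"
    using compatible_metric_separates_coordinate[OF \<rho> one_closed] by blast
  show "ereal (ln ?Z) \<le> sofic_pressure_wrt G d \<sigma> (full_shift G k) (left_shift G) ?f \<rho>"
    unfolding sofic_pressure_wrt_def
  proof (rule SUP_upper2[of r], use r(1) in simp, intro INF_greatest, rule ereal_le_of_all_less)
    fix F and \<delta> e :: real
    assume F: "F \<in> {F. finite F \<and> F \<noteq> {} \<and> F \<subseteq> carrier G}" and "\<delta> \<in> {0<..}" "e > 0"
    define \<delta>' where "\<delta>' = min \<delta> (e/2)"
    have \<delta>': "\<delta>' > 0" "\<delta>' \<le> \<delta>" "\<delta>' \<le> e/2" using \<open>\<delta> \<in> {0<..}\<close> \<open>e > 0\<close> by (auto simp: \<delta>'_def)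
    have F': "finite F" "F \<noteq> {}" "F \<subseteq> carrier G" using F by simp_all
    have "e/2 > 0" using \<open>e > 0\<close> by simp
    have cont: "continuous_map (full_shift G k) euclideanreal g" if "g \<in> {?f}" for g
      using that continuous_map_coordinate_function[OF one_closed] by simp
    have int_f: "integral\<^sup>L ?M ?f = ?c" by (rule integral_PiM_gibbs_coordinate[OF k one_closed])
    have "\<forall>\<^sub>F i in sequentially. ennreal (exp (real (d i) * (ln ?Z - ?c - e/2)))
      \<le> max_separated r (Map_sofic_measure (full_shift G k) (left_shift G) ?M \<rho> F {?f} \<delta>' (d i) (\<sigma> i)) (rho_inf (d i) \<rho>)"
      by (rule eventually_max_separated_ge[where a=a and k=k and \<rho>=\<rho> and r=r];
          (fact F' G sofic count k \<rho> r cont \<delta>'(1) \<open>e/2 > 0\<close> finite.emptyI[THEN finite.insertI]))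
    with sofic_dimension_pos[OF G sofic]
    have "\<forall>\<^sub>F i in sequentially. ereal (ln ?Z - e) \<le> ereal (1 / real (d i)) *
        ext_log (pressure_sum ?f (full_shift G k) (left_shift G) \<rho> r F \<delta> (d i) (\<sigma> i))"
    proof eventually_elim
      case (elim i)
      have "ennreal (exp (real (d i) * (ln ?Z - e)))
          \<le> ennreal (exp (real (d i) * (?c - \<delta>')) * exp (real (d i) * (ln ?Z - ?c - e/2)))"
      proof (rule ennreal_leI)
        have "real (d i) * (ln ?Z - e) \<le> real (d i) * ((?c - \<delta>') + (ln ?Z - ?c - e/2))"
          using \<delta>'(3) by (intro mult_left_mono) auto
        then show "exp (real (d i) * (ln ?Z - e))
            \<le> exp (real (d i) * (?c - \<delta>')) * exp (real (d i) * (ln ?Z - ?c - e/2))"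
          unfolding exp_add[symmetric] distrib_left[symmetric] by (simp only: exp_le_cancel_iff)
      qed
      also have "\<dots> = ennreal (exp (real (d i) * (?c - \<delta>'))) * ennreal (exp (real (d i) * (ln ?Z - ?c - e/2)))"
        by (rule ennreal_mult) simp_all
      also have "\<dots> \<le> ennreal (exp (real (d i) * (?c - \<delta>'))) * max_separated r
          (Map_sofic_measure (full_shift G k) (left_shift G) ?M \<rho> F {?f} \<delta>' (d i) (\<sigma> i)) (rho_inf (d i) \<rho>)"
        by (intro mult_left_mono elim(2)) simp
      also have "\<dots> \<le> pressure_sum ?f (full_shift G k) (left_shift G) \<rho> r F \<delta>' (d i) (\<sigma> i)"
        unfolding int_f[symmetric] by (rule max_separated_le_pressure_sum) (use elim(1) in simp_all)
      also have "\<dots> \<le> pressure_sum ?f (full_shift G k) (left_shift G) \<rho> r F \<delta> (d i) (\<sigma> i)"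
        by (rule pressure_sum_mono[OF \<delta>'(2)])
      finally show ?case by (rule growth_rate_ge[OF elim(1)])
    qed
    then show "ereal (ln ?Z - e) \<le> limsup (\<lambda>i. ereal (1 / real (d i)) *
        ext_log (pressure_sum ?f (full_shift G k) (left_shift G) \<rho> r F \<delta> (d i) (\<sigma> i)))"
      by (intro le_Limsup) simp_all
  qed
qed

text \<open>Here the comparison is used in the other direction: with the potential as test function, too many
separated maps would exceed the bound on the pressure sum.\<close>

lemma sofic_entropy_wrt_full_shift:
  "sofic_entropy_wrt G d \<sigma> (full_shift G k) (left_shift G) (Pi\<^sub>M (carrier G) (\<lambda>_. gibbs_measure k a)) \<rho>
    = ereal (ln (\<Sum>j<k. exp (a j)) - (\<Sum>i<k. exp (a i) / (\<Sum>j<k. exp (a j)) * a i))"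
proof (rule antisym)
  let ?f = "\<lambda>x. a (x \<one>) :: real"
  let ?Z = "\<Sum>j<k. exp (a j)"
  let ?M = "Pi\<^sub>M (carrier G) (\<lambda>_. gibbs_measure k a)"
  let ?c = "\<Sum>i<k. exp (a i) / ?Z * a i"
  let ?Map = "Map_sofic_measure (full_shift G k) (left_shift G) ?M \<rho>"
  have int_f: "integral\<^sup>L ?M ?f = ?c" by (rule integral_PiM_gibbs_coordinate[OF k one_closed])
  show "sofic_entropy_wrt G d \<sigma> (full_shift G k) (left_shift G) ?M \<rho> \<le> ereal (ln ?Z - ?c)"
    unfolding sofic_entropy_wrt_def
  proof (rule SUP_least, rule ereal_le_of_all_greater)
    fix \<epsilon> \<eta> :: real assume "\<epsilon> \<in> {0<..}" "\<eta> > 0"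
    then have "\<epsilon> > 0" "\<eta>/2 > 0" by simp_all
    obtain F \<delta> where F: "finite F" "F \<noteq> {}" "F \<subseteq> carrier G" "\<delta> > 0"
      and le: "\<And>n \<sigma>. n > 0 \<Longrightarrow> (\<And>s. s \<in> carrier G \<Longrightarrow> \<sigma> s permutes {1..n}) \<Longrightarrow>
        pressure_sum ?f (full_shift G k) (left_shift G) \<rho> \<epsilon> F \<delta> n \<sigma> \<le> ennreal (exp (real n * (ln ?Z + \<eta>/2)))"
      using pressure_sum_upper_bound[OF G k \<rho> \<open>\<epsilon> > 0\<close> \<open>\<eta>/2 > 0\<close>] by blast
    define \<delta>' where "\<delta>' = min \<delta> (\<eta>/2)"
    have \<delta>': "\<delta>' > 0" "\<delta>' \<le> \<delta>" "\<delta>' \<le> \<eta>/2" using \<open>\<delta> > 0\<close> \<open>\<eta>/2 > 0\<close> by (auto simp: \<delta>'_def)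
    have "limsup (\<lambda>i. ereal (1 / real (d i)) *
        ext_log (max_separated \<epsilon> (?Map F {?f} \<delta>' (d i) (\<sigma> i)) (rho_inf (d i) \<rho>))) \<le> ereal (ln ?Z - ?c + \<eta>)"
    proof (rule Limsup_bounded)
      show "\<forall>\<^sub>F i in sequentially. ereal (1 / real (d i)) *
        ext_log (max_separated \<epsilon> (?Map F {?f} \<delta>' (d i) (\<sigma> i)) (rho_inf (d i) \<rho>)) \<le> ereal (ln ?Z - ?c + \<eta>)"
        using sofic_dimension_pos[OF G sofic]
      proof eventually_elim
        case (elim i)
        let ?n = "real (d i)"
        let ?N = "max_separated \<epsilon> (?Map F {?f} \<delta>' (d i) (\<sigma> i)) (rho_inf (d i) \<rho>)"
        have "ennreal (exp (?n * (?c - \<delta>'))) * ?N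
            \<le> pressure_sum ?f (full_shift G k) (left_shift G) \<rho> \<epsilon> F \<delta>' (d i) (\<sigma> i)"
          unfolding int_f[symmetric] by (rule max_separated_le_pressure_sum) (use elim in simp_all)
        also have "\<dots> \<le> pressure_sum ?f (full_shift G k) (left_shift G) \<rho> \<epsilon> F \<delta> (d i) (\<sigma> i)"
          by (rule pressure_sum_mono[OF \<delta>'(2)])
        also have "\<dots> \<le> ennreal (exp (?n * (ln ?Z + \<eta>/2)))"
          by (intro le elim sofic_permutes[OF G sofic])
        finally have mult: "ennreal (exp (?n * (?c - \<delta>'))) * ?N \<le> ennreal (exp (?n * (ln ?Z + \<eta>/2)))" .
        have "?N = ennreal (exp (- (?n * (?c - \<delta>'))) * exp (?n * (?c - \<delta>'))) * ?N"
          by (simp add: exp_add[symmetric])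
        also have "\<dots> = ennreal (exp (- (?n * (?c - \<delta>')))) * (ennreal (exp (?n * (?c - \<delta>'))) * ?N)"
          by (simp add: ennreal_mult mult.assoc)
        also have "\<dots> \<le> ennreal (exp (- (?n * (?c - \<delta>')))) * ennreal (exp (?n * (ln ?Z + \<eta>/2)))"
          by (intro mult_left_mono mult) simp
        also have "\<dots> = ennreal (exp (- (?n * (?c - \<delta>')) + ?n * (ln ?Z + \<eta>/2)))"
          unfolding exp_add by (rule ennreal_mult[symmetric]) simp_all
        also have "\<dots> \<le> ennreal (exp (?n * (ln ?Z - ?c + \<eta>)))"
        proof -
          have "?n * (- (?c - \<delta>') + (ln ?Z + \<eta>/2)) \<le> ?n * (ln ?Z - ?c + \<eta>)"
            using \<delta>'(3) by (intro mult_left_mono) auto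
          then show ?thesis unfolding distrib_left mult_minus_right by (intro ennreal_leI) (simp only: exp_le_cancel_iff)
        qed
        finally show ?case by (rule growth_rate_le[OF elim])
      qed
    qed
    then show "(INF F\<in>{F. finite F \<and> F \<noteq> {} \<and> F \<subseteq> carrier G}.
        INF L\<in>{L. finite L \<and> L \<noteq> {} \<and> (\<forall>g\<in>L. continuous_map (full_shift G k) euclideanreal g)}. INF \<delta>\<in>{0<..}.
        limsup (\<lambda>i. ereal (1 / real (d i)) * ext_log (max_separated \<epsilon> (?Map F L \<delta> (d i) (\<sigma> i)) (rho_inf (d i) \<rho>))))
        \<le> ereal (ln ?Z - ?c + \<eta>)"
      using F \<delta>'(1) continuous_map_coordinate_function[OF one_closed, of k a]
      by (intro INF_lower2[of F] INF_lower2[of "{?f}"] INF_lower2[of \<delta>']) auto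
  qed
  obtain r where r: "r > 0" "\<And>x y. x \<in> topspace (full_shift G k) \<Longrightarrow>
      y \<in> topspace (full_shift G k) \<Longrightarrow> \<rho> x y < r \<Longrightarrow> x \<one> = y \<one>"
    using compatible_metric_separates_coordinate[OF \<rho> one_closed] by blast
  show "ereal (ln ?Z - ?c) \<le> sofic_entropy_wrt G d \<sigma> (full_shift G k) (left_shift G) ?M \<rho>"
    unfolding sofic_entropy_wrt_def
  proof (rule SUP_upper2[of r], use r(1) in simp, intro INF_greatest, rule ereal_le_of_all_less)
    fix F L and \<delta> e :: real
    assume F: "F \<in> {F. finite F \<and> F \<noteq> {} \<and> F \<subseteq> carrier G}" and "\<delta> \<in> {0<..}" "e > 0"
      and L: "L \<in> {L. finite L \<and> L \<noteq> {} \<and> (\<forall>g\<in>L. continuous_map (full_shift G k) euclideanreal g)}"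
    have F': "finite F" "F \<noteq> {}" "F \<subseteq> carrier G" using F by simp_all
    have L': "finite L" "\<And>g. g \<in> L \<Longrightarrow> continuous_map (full_shift G k) euclideanreal g" using L by simp_all
    have "\<delta> > 0" using \<open>\<delta> \<in> {0<..}\<close> by simp
    have "\<forall>\<^sub>F i in sequentially. ennreal (exp (real (d i) * (ln ?Z - ?c - e)))
      \<le> max_separated r (?Map F L \<delta> (d i) (\<sigma> i)) (rho_inf (d i) \<rho>)"
      by (rule eventually_max_separated_ge[where a=a and k=k and \<rho>=\<rho> and r=r];
          (fact F' L' G sofic count k \<rho> r \<open>\<delta> > 0\<close> \<open>e > 0\<close>))
    with sofic_dimension_pos[OF G sofic]
    have "\<forall>\<^sub>F i in sequentially. ereal (ln ?Z - ?c - e) \<le> ereal (1 / real (d i)) *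
        ext_log (max_separated r (?Map F L \<delta> (d i) (\<sigma> i)) (rho_inf (d i) \<rho>))"
      by eventually_elim (rule growth_rate_ge)
    then show "ereal (ln ?Z - ?c - e) \<le> limsup (\<lambda>i. ereal (1 / real (d i)) *
        ext_log (max_separated r (?Map F L \<delta> (d i) (\<sigma> i)) (rho_inf (d i) \<rho>)))"
      by (intro le_Limsup) simp_all
  qed
qed

end

text \<open>Apply \<open>ln x \<le> x - 1\<close> to the ratio of the Gibbs weight and \<open>measure p {i}\<close> for each \<open>i\<close>, and average
with respect to \<open>p\<close>.\<close>

lemma gibbs_inequality:
  fixes a :: "nat \<Rightarrow> real"
  assumes "k \<ge> 1" and p: "p \<in> prob_measures k"
  shows "shannon_entropy k p + (\<Sum>i<k. measure p {i} * a i) \<le> ln (\<Sum>j<k. exp (a j))"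
proof -
  let ?Z = "\<Sum>j<k. exp (a j)"
  have Z: "?Z > 0" by (rule gibbs_normaliser_pos[OF assms(1)])
  interpret p: prob_space p using p by (simp add: prob_measures_def)
  have sets_p: "sets p = Pow {..<k}" using p by (simp add: prob_measures_def)
  have "(\<Sum>i<k. measure p {i}) = measure p {..<k}"
    using sets_p by (intro p.finite_measure_eq_sum_singleton[symmetric]) auto
  then have sum1: "(\<Sum>i<k. measure p {i}) = 1"
    using p.prob_space sets_eq_imp_space_eq[of p "count_space {..<k}"] sets_p by simp
  have le: "- measure p {i} * ln (measure p {i}) + measure p {i} * a i - measure p {i} * ln ?Z
      \<le> exp (a i) / ?Z - measure p {i}" for i
  proof (cases "measure p {i} = 0")
    case False
    then have pos: "measure p {i} > 0" using measure_nonneg[of p "{i}"] by linarith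
    have "ln (exp (a i) / ?Z / measure p {i}) = a i - ln ?Z - ln (measure p {i})"
      using ln_div[of "exp (a i) / ?Z" "measure p {i}"] ln_div[of "exp (a i)" ?Z] pos Z
      by (simp del: divide_divide_eq_left)
    moreover have "ln (exp (a i) / ?Z / measure p {i}) \<le> exp (a i) / ?Z / measure p {i} - 1"
      using pos Z by (intro ln_le_minus_one) simp
    ultimately have "measure p {i} * (a i - ln ?Z - ln (measure p {i}))
        \<le> measure p {i} * (exp (a i) / ?Z / measure p {i} - 1)"
      using pos by (intro mult_left_mono) auto
    also have "\<dots> = exp (a i) / ?Z - measure p {i}" using pos by (simp add: right_diff_distrib)
    finally show ?thesis by (simp add: algebra_simps)
  qed (use Z in simp)
  have "shannon_entropy k p + (\<Sum>i<k. measure p {i} * a i) - ln ?Z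
      = (\<Sum>i<k. - measure p {i} * ln (measure p {i}) + measure p {i} * a i - measure p {i} * ln ?Z)"
    by (simp add: shannon_entropy_def sum.distrib sum_subtractf sum_negf sum_distrib_right[symmetric] sum1)
  also have "\<dots> \<le> (\<Sum>i<k. exp (a i) / ?Z - measure p {i})" by (intro sum_mono le)
  also have "\<dots> = 0" using Z by (simp add: sum_subtractf sum1 sum_divide_distrib[symmetric])
  finally show ?thesis by simp
qed

lemma SUP_entropy_plus_energy:
  fixes a :: "nat \<Rightarrow> real"
  assumes "k \<ge> 1"
  shows "(SUP p\<in>prob_measures k. ereal (shannon_entropy k p + (\<Sum>i<k. measure p {i} * a i)))
    = ereal (ln (\<Sum>j<k. exp (a j)))"
proof (rule antisym)
  let ?Z = "\<Sum>j<k. exp (a j)"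
  let ?p = "gibbs_measure k a"
  have Z: "?Z > 0" by (rule gibbs_normaliser_pos[OF assms])
  show "(SUP p\<in>prob_measures k. ereal (shannon_entropy k p + (\<Sum>i<k. measure p {i} * a i))) \<le> ereal (ln ?Z)"
    using gibbs_inequality[OF assms] by (intro SUP_least) simp
  have "shannon_entropy k ?p + (\<Sum>i<k. measure ?p {i} * a i)
      = (\<Sum>i<k. - (exp (a i) / ?Z) * ln (exp (a i) / ?Z) + exp (a i) / ?Z * a i)"
    unfolding shannon_entropy_def sum.distrib[symmetric]
    by (intro sum.cong refl) (simp add: measure_gibbs[OF assms])
  also have "\<dots> = (\<Sum>i<k. exp (a i) / ?Z * ln ?Z)"
  proof (intro sum.cong refl)
    fix i
    have "- q * (x - z) + q * x = q * z" for q x z :: real by (simp add: algebra_simps)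
    moreover have "ln (exp (a i) / ?Z) = a i - ln ?Z" using ln_div[of "exp (a i)" ?Z] Z by simp
    ultimately show "- (exp (a i) / ?Z) * ln (exp (a i) / ?Z) + exp (a i) / ?Z * a i = exp (a i) / ?Z * ln ?Z"
      by (simp only:)
  qed
  also have "\<dots> = ln ?Z"
    using Z by (simp add: sum_distrib_right[symmetric] sum_divide_distrib[symmetric])
  finally have "ereal (ln ?Z) = ereal (shannon_entropy k ?p + (\<Sum>i<k. measure ?p {i} * a i))" by simp
  moreover have "?p \<in> prob_measures k"
    using prob_space_gibbs[OF assms] sets_gibbs[OF assms] by (simp add: prob_measures_def)
  ultimately show "ereal (ln ?Z) \<le> (SUP p\<in>prob_measures k. ereal (shannon_entropy k p + (\<Sum>i<k. measure p {i} * a i)))"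
    by (intro SUP_upper2[of ?p]) simp_all
qed

theorem theorem5p3:
  fixes G :: "('g, 'm) monoid_scheme"
    and k :: nat
    and a :: "nat \<Rightarrow> real"
    and d :: "nat \<Rightarrow> nat"
    and \<sigma> :: "nat \<Rightarrow> 'g \<Rightarrow> nat \<Rightarrow> nat"
  assumes "group G"
    and "countable (carrier G)"
    and "k \<ge> 1"
    and "sofic_approximation G d \<sigma>"
  shows
    "sofic_pressure G d \<sigma> (full_shift G k) (left_shift G) (\<lambda>x. a (x \<one>\<^bsub>G\<^esub>))
       = (SUP p\<in>prob_measures k. ereal (shannon_entropy k p + (\<Sum>i<k. measure p {i} * a i)))
     \<and> (SUP p\<in>prob_measures k. ereal (shannon_entropy k p + (\<Sum>i<k. measure p {i} * a i)))
       = ereal (ln (\<Sum>j<k. exp (a j)))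
     \<and> equilibrium_state G d \<sigma> (full_shift G k) (left_shift G) (\<lambda>x. a (x \<one>\<^bsub>G\<^esub>))
         (Pi\<^sub>M (carrier G) (\<lambda>_. gibbs_measure k a))"
proof -
  interpret group G by fact
  let ?M = "Pi\<^sub>M (carrier G) (\<lambda>_. gibbs_measure k a)"
  let ?Z = "\<Sum>j<k. exp (a j)"
  let ?c = "\<Sum>i<k. exp (a i) / ?Z * a i"
  obtain \<rho> where \<rho>: "compatible_metric (full_shift G k) \<rho>"
    using ex_compatible_metric[OF assms(2)] by blast
  have the_value: "(THE P. \<forall>\<rho>. compatible_metric (full_shift G k) \<rho> \<longrightarrow> h \<rho> = P) = v"
    if "\<And>\<rho>. compatible_metric (full_shift G k) \<rho> \<Longrightarrow> h \<rho> = v" for h :: "_ \<Rightarrow> ereal" and v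
    using that \<rho> by (intro the_equality) auto
  have P: "sofic_pressure G d \<sigma> (full_shift G k) (left_shift G) (\<lambda>x. a (x \<one>\<^bsub>G\<^esub>)) = ereal (ln ?Z)"
    unfolding sofic_pressure_def by (intro the_value sofic_pressure_wrt_full_shift assms)
  have h: "sofic_entropy G d \<sigma> (full_shift G k) (left_shift G) ?M = ereal (ln ?Z - ?c)"
    unfolding sofic_entropy_def by (intro the_value sofic_entropy_wrt_full_shift assms)
  have "integral\<^sup>L ?M (\<lambda>x. a (x \<one>\<^bsub>G\<^esub>)) = ?c"
    by (rule integral_PiM_gibbs_coordinate[OF assms(3) one_closed])
  moreover have "invariant_borel_prob G (full_shift G k) (left_shift G) ?M"
    by (intro invariant_borel_prob_PiM prob_space_gibbs sets_gibbs assms)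
  ultimately have "equilibrium_state G d \<sigma> (full_shift G k) (left_shift G) (\<lambda>x. a (x \<one>\<^bsub>G\<^esub>)) ?M"
    unfolding equilibrium_state_def by (simp add: P h)
  then show ?thesis using P SUP_entropy_plus_energy[OF assms(3), of a] by simp
qed

end
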